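(* Let $d,n,m\in\mathbb{Z}_{>0}$ and let $\boldsymbol{\tau}$ be the unique Markov trace on $\mathrm{Y}(d,m,n)$ with parameters $z=0$ and $x_{a,b}=\delta_{a,0}\delta_{b,0}$ for $a\in E_m$, $b\in\{0,\ldots,d-1\}$. The Markov trace $\boldsymbol{\tau}$ is given on the $\mathcal{R}_m$-basis $$\mathcal{B}_n=\{X_1^{a_1}\cdots X_n^{a_n}\,t_1^{b_1}\cdots t_n^{b_n}\,g_w\ |\ a_1,\ldots,a_n\in E_m,\ b_1,\ldots,b_n\in\{0,\ldots,d-1\},\ w\in\mathfrak{S}_n\}$$ of $\mathrm{Y}(d,m,n)$ by $$\boldsymbol{\tau}(X_1^{a_1}\cdots X_n^{a_n}\,t_1^{b_1}\cdots t_n^{b_n}\,g_w)=\begin{cases}1,&\text{if } w=1\text{ and } a_1=\cdots=a_n=b_1=\cdots=b_n=0;\\0,&\text{otherwise.}\end{cases}$$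
   Context: Algebra. Let $q,v_1,\ldots,v_m$ be indeterminates, $\mathcal{R}_m:=\mathbb{C}[q^{\pm1},v_1^{\pm1},\ldots,v_m^{\pm1}]$ and $E_m:=\{0,\ldots,m-1\}$. The cyclotomic Yokonuma--Hecke algebra $\mathrm{Y}(d,m,n)$ is the associative $\mathcal{R}_m$-algebra generated by $t_1,\ldots,t_n,g_1,\ldots,g_{n-1},X_1^{\pm1}$ with relations: $g_ig_j=g_jg_i$ if $|i-j|>1$; $g_ig_{i+1}g_i=g_{i+1}g_ig_{i+1}$; $t_it_j=t_jt_i$; $t_jg_i=g_it_{s_i(j)}$ with $s_i=(i,i+1)$; $t_j^d=1$; $g_i^2=1+(q-q^{-1})e_ig_i$ with $e_i:=\frac1d\sum_{s=0}^{d-1}t_i^st_{i+1}^{-s}$; $X_1g_1X_1g_1=g_1X_1g_1X_1$; $X_1g_i=g_iX_1$ for $i\ge2$; $X_1t_j=t_jX_1$ for all $j$; and $(X_1-v_1)\cdots(X_1-v_m)=0$. Each $g_i$ is invertible with $g_i^{-1}=g_i-(q-q^{-1})e_i$. $\mathrm{Y}(d,m,0):=\mathcal{R}_m$, and $\mathrm{Y}(d,m,k)$ for $k\le n$ is identified with the subalgebra of $\mathrm{Y}(d,m,n)$ generated by $t_1,\ldots,t_k,g_1,\ldots,g_{k-1},X_1^{\pm1}$. Put $X_{i+1}:=g_iX_ig_i$, and $\widetilde X_1:=X_1$, $\widetilde X_{i+1}:=g_i^{-1}\widetilde X_ig_i$. For $w\in\mathfrak{S}_n$ with reduced expression $w=s_{i_1}\cdots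 s_{i_r}$, $g_w:=g_{i_1}\cdots g_{i_r}$ (well defined). Markov trace. Given $z,x_{a,b}\in\mathcal{R}_m$ ($a\in E_m$, $0\le b\le d-1$) with $x_{0,0}=1$, the Markov trace on $\mathrm{Y}(d,m,n)$ with these parameters is the unique $\mathcal{R}_m$-linear map $\mathrm{tr}:\mathrm{Y}(d,m,n)\to\mathcal{R}_m$ with $\mathrm{tr}(1)=1$, $\mathrm{tr}(YZ)=\mathrm{tr}(ZY)$ for all $Y,Z$; $\mathrm{tr}(g_{k-1}u)=z\,\mathrm{tr}(u)$ for $2\le k\le n$, $u\in\mathrm{Y}(d,m,k-1)$; $\mathrm{tr}(\widetilde X_k^at_k^bu)=x_{a,b}\mathrm{tr}(u)$ for $1\le k\le n$, $u\in\mathrm{Y}(d,m,k-1)$, $a\in E_m$, $0\le b\le d-1$. It exists for every choice of parameters. *)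

theory Defs
  imports
    "HOL-Library.Poly_Mapping"
    "HOL-Combinatorics.Permutations"
    "HOL-Algebra.QuotRing"
    "HOL-Algebra.Generated_Rings"
    Complex_Main
begin

section \<open>The Laurent polynomial ring\<close>

text \<open>
  Laurent polynomials in countably many indeterminates form the group algebra of the finitely
  supported integer exponent vectors.  Index 0 is reserved for \<open>q\<close> and index \<open>i \<ge> 1\<close> for \<open>v\<^sub>i\<close>;
  \<open>laurent_ring m\<close> is the subring \<open>\<complex>[q\<^sup>\<plusminus>\<^sup>1, v\<^sub>1\<^sup>\<plusminus>\<^sup>1, \<dots>, v\<^sub>m\<^sup>\<plusminus>\<^sup>1]\<close>.
\<close>

type_synonym laurent = "(nat \<Rightarrow>\<^sub>0 int) \<Rightarrow>\<^sub>0 complex"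

definition laurent_ring :: "nat \<Rightarrow> laurent set" where
  "laurent_ring m = {p. \<forall>e\<in>Poly_Mapping.keys p. Poly_Mapping.keys e \<subseteq> {0..m}}"

definition q_var :: laurent where
  "q_var = Poly_Mapping.single (Poly_Mapping.single 0 1) 1"

definition q_inv :: laurent where
  "q_inv = Poly_Mapping.single (Poly_Mapping.single 0 (- 1)) 1"

definition v_var :: "nat \<Rightarrow> laurent" where
  "v_var i = Poly_Mapping.single (Poly_Mapping.single i 1) 1"

definition laurent_const :: "complex \<Rightarrow> laurent" where
  "laurent_const c = Poly_Mapping.single 0 c"

section \<open>The free associative algebra\<close>

datatype letter = LT nat | LG nat | LX | LXinv

text \<open>
  Words form the free monoid, written additively because \<open>Poly_Mapping\<close> takes the monoid
  algebra over an additive monoid of keys.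
\<close>

datatype gen_word = Word (letters: "letter list")

instantiation gen_word :: monoid_add
begin

definition "0 = Word []"

definition "u + v = Word (letters u @ letters v)"

instance
  by intro_classes (simp_all add: zero_gen_word_def plus_gen_word_def)

end

type_synonym nc_poly = "gen_word \<Rightarrow>\<^sub>0 laurent"

definition gen :: "letter \<Rightarrow> nc_poly" where
  "gen l = Poly_Mapping.single (Word [l]) 1"

definition scal :: "laurent \<Rightarrow> nc_poly" where
  "scal c = Poly_Mapping.single 0 c"

text \<open>
  \<open>gens 0\<close> is empty in accordance with the convention that the algebra for \<open>n = 0\<close> is the
  ground ring.
\<close>

definition gens :: "nat \<Rightarrow> letter set" where
  "gens n = (if n = 0 then {} else LT ` {1..n} \<union> LG ` {1..<n} \<union> {LX, LXinv})"

definition free_alg :: "nat \<Rightarrow> nat \<Rightarrow> nc_poly ring" where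
  "free_alg m n =
     \<lparr>carrier = {f. \<forall>w\<in>Poly_Mapping.keys f.
                   set (letters w) \<subseteq> gens n \<and> Poly_Mapping.lookup f w \<in> laurent_ring m},
      mult = (*), one = 1, zero = 0, add = (+)\<rparr>"

section \<open>The cyclotomic Yokonuma--Hecke algebra\<close>

text \<open>
  Since \<open>t\<^sub>i\<^sub>+\<^sub>1\<^sup>d = 1\<close> is imposed, \<open>t\<^sub>i\<^sub>+\<^sub>1\<^sup>-\<^sup>s\<close> is written as \<open>t\<^sub>i\<^sub>+\<^sub>1\<^sup>d\<^sup>-\<^sup>s\<close> for \<open>0 \<le> s < d\<close>.
\<close>

definition e_elt :: "nat \<Rightarrow> nat \<Rightarrow> nc_poly" where
  "e_elt d i = scal (laurent_const (1 / of_nat d)) *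
     (\<Sum>s<d. gen (LT i) ^ s * gen (LT (Suc i)) ^ (d - s))"

text \<open>A relation \<open>lhs = rhs\<close> is recorded as the element \<open>lhs - rhs\<close>; used for \<open>n \<ge> 1\<close> only.\<close>

definition relators :: "nat \<Rightarrow> nat \<Rightarrow> nat \<Rightarrow> nc_poly set" where
  "relators d m n =
     {gen (LG i) * gen (LG j) - gen (LG j) * gen (LG i) | i j.
        i \<in> {1..<n} \<and> j \<in> {1..<n} \<and> (i + 1 < j \<or> j + 1 < i)} \<union>
     {gen (LG i) * gen (LG (i + 1)) * gen (LG i)
        - gen (LG (i + 1)) * gen (LG i) * gen (LG (i + 1)) | i.
        i \<in> {1..<n} \<and> i + 1 \<in> {1..<n}} \<union>
     {gen (LT i) * gen (LT j) - gen (LT j) * gen (LT i) | i j. i \<in> {1..n} \<and> j \<in> {1..n}} \<union>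
     {gen (LT j) * gen (LG i) - gen (LG i) * gen (LT (Transposition.transpose i (i + 1) j)) | i j.
        i \<in> {1..<n} \<and> j \<in> {1..n}} \<union>
     {gen (LT j) ^ d - 1 | j. j \<in> {1..n}} \<union>
     {gen (LG i) ^ 2 - (1 + scal (q_var - q_inv) * e_elt d i * gen (LG i)) | i. i \<in> {1..<n}} \<union>
     (if n \<ge> 2
      then {gen LX * gen (LG 1) * gen LX * gen (LG 1) - gen (LG 1) * gen LX * gen (LG 1) * gen LX}
      else {}) \<union>
     {gen LX * gen (LG i) - gen (LG i) * gen LX | i. i \<in> {2..<n}} \<union>
     {gen LX * gen (LT j) - gen (LT j) * gen LX | j. j \<in> {1..n}} \<union>
     {gen LX * gen LXinv - 1, gen LXinv * gen LX - 1} \<union>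
     {\<Prod>i\<leftarrow>[1..<Suc m]. gen LX - scal (v_var i)}"

definition rel_ideal :: "nat \<Rightarrow> nat \<Rightarrow> nat \<Rightarrow> nc_poly set" where
  "rel_ideal d m n = genideal (free_alg m n) (relators d m n)"

definition YH :: "nat \<Rightarrow> nat \<Rightarrow> nat \<Rightarrow> nc_poly set ring" where
  "YH d m n = free_alg m n Quot rel_ideal d m n"

definition cls :: "nat \<Rightarrow> nat \<Rightarrow> nat \<Rightarrow> nc_poly \<Rightarrow> nc_poly set" where
  "cls d m n f = rel_ideal d m n +>\<^bsub>free_alg m n\<^esub> f"

abbreviation t_elt :: "nat \<Rightarrow> nat \<Rightarrow> nat \<Rightarrow> nat \<Rightarrow> nc_poly set" where
  "t_elt d m n i \<equiv> cls d m n (gen (LT i))"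

abbreviation g_elt :: "nat \<Rightarrow> nat \<Rightarrow> nat \<Rightarrow> nat \<Rightarrow> nc_poly set" where
  "g_elt d m n i \<equiv> cls d m n (gen (LG i))"

text \<open>
  \<open>subYH d m n k\<close> is the algebra on \<open>k \<le> n\<close> strands, viewed inside \<open>YH d m n\<close> as the
  subalgebra generated by the corresponding generators; it consists of the scalars for \<open>k = 0\<close>.
\<close>

definition subYH :: "nat \<Rightarrow> nat \<Rightarrow> nat \<Rightarrow> nat \<Rightarrow> nc_poly set set" where
  "subYH d m n k = generate_ring (YH d m n)
     ((\<lambda>c. cls d m n (scal c)) ` laurent_ring m \<union> (\<lambda>l. cls d m n (gen l)) ` gens k)"

text \<open>The elements \<open>X\<^sub>i\<close> and their conjugation variants; the value at index 0 is junk.\<close>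

fun X_elt :: "nat \<Rightarrow> nat \<Rightarrow> nat \<Rightarrow> nat \<Rightarrow> nc_poly set" where
  "X_elt d m n 0 = \<one>\<^bsub>YH d m n\<^esub>"
| "X_elt d m n (Suc 0) = cls d m n (gen LX)"
| "X_elt d m n (Suc (Suc i)) =
     g_elt d m n (Suc i) \<otimes>\<^bsub>YH d m n\<^esub> X_elt d m n (Suc i) \<otimes>\<^bsub>YH d m n\<^esub> g_elt d m n (Suc i)"

fun Xt_elt :: "nat \<Rightarrow> nat \<Rightarrow> nat \<Rightarrow> nat \<Rightarrow> nc_poly set" where
  "Xt_elt d m n 0 = \<one>\<^bsub>YH d m n\<^esub>"
| "Xt_elt d m n (Suc 0) = cls d m n (gen LX)"
| "Xt_elt d m n (Suc (Suc i)) =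
     inv\<^bsub>YH d m n\<^esub> (g_elt d m n (Suc i)) \<otimes>\<^bsub>YH d m n\<^esub> Xt_elt d m n (Suc i)
       \<otimes>\<^bsub>YH d m n\<^esub> g_elt d m n (Suc i)"

definition lprod :: "('a, 'b) monoid_scheme \<Rightarrow> 'a list \<Rightarrow> 'a" where
  "lprod A xs = foldr (mult A) xs (one A)"

section \<open>Reduced expressions\<close>

definition perm_of_word :: "nat list \<Rightarrow> nat \<Rightarrow> nat" where
  "perm_of_word is = foldr (\<lambda>i p. Transposition.transpose i (i + 1) \<circ> p) is id"

definition reduced_expr :: "nat \<Rightarrow> (nat \<Rightarrow> nat) \<Rightarrow> nat list \<Rightarrow> bool" where
  "reduced_expr n w is \<longleftrightarrow>
     set is \<subseteq> {1..<n} \<and> perm_of_word is = w \<and>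
     (\<forall>js. set js \<subseteq> {1..<n} \<and> perm_of_word js = w \<longrightarrow> length is \<le> length js)"

text \<open>By Matsumoto's theorem the value does not depend on the reduced expression chosen.\<close>

definition g_perm :: "nat \<Rightarrow> nat \<Rightarrow> nat \<Rightarrow> (nat \<Rightarrow> nat) \<Rightarrow> nc_poly set" where
  "g_perm d m n w = lprod (YH d m n) (map (g_elt d m n) (SOME is. reduced_expr n w is))"

definition basis_elt ::
  "nat \<Rightarrow> nat \<Rightarrow> nat \<Rightarrow> (nat \<Rightarrow> nat) \<Rightarrow> (nat \<Rightarrow> nat) \<Rightarrow> (nat \<Rightarrow> nat) \<Rightarrow> nc_poly set" where
  "basis_elt d m n a b w =
     lprod (YH d m n) (map (\<lambda>i. X_elt d m n i [^]\<^bsub>YH d m n\<^esub> a i) [1..<Suc n])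
     \<otimes>\<^bsub>YH d m n\<^esub> lprod (YH d m n) (map (\<lambda>i. t_elt d m n i [^]\<^bsub>YH d m n\<^esub> b i) [1..<Suc n])
     \<otimes>\<^bsub>YH d m n\<^esub> g_perm d m n w"

section \<open>Markov traces\<close>

definition markov_trace ::
  "nat \<Rightarrow> nat \<Rightarrow> nat \<Rightarrow> laurent \<Rightarrow> (nat \<Rightarrow> nat \<Rightarrow> laurent) \<Rightarrow> (nc_poly set \<Rightarrow> laurent) \<Rightarrow> bool" where
  "markov_trace d m n z x tr \<longleftrightarrow>
     z \<in> laurent_ring m \<and> (\<forall>a<m. \<forall>b<d. x a b \<in> laurent_ring m) \<and> x 0 0 = 1 \<and>
     tr \<in> carrier (YH d m n) \<rightarrow> laurent_ring m \<and>
     (\<forall>y\<in>carrier (YH d m n). \<forall>y'\<in>carrier (YH d m n).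
        tr (y \<oplus>\<^bsub>YH d m n\<^esub> y') = tr y + tr y') \<and>
     (\<forall>c\<in>laurent_ring m. \<forall>y\<in>carrier (YH d m n).
        tr (cls d m n (scal c) \<otimes>\<^bsub>YH d m n\<^esub> y) = c * tr y) \<and>
     tr \<one>\<^bsub>YH d m n\<^esub> = 1 \<and>
     (\<forall>y\<in>carrier (YH d m n). \<forall>y'\<in>carrier (YH d m n).
        tr (y \<otimes>\<^bsub>YH d m n\<^esub> y') = tr (y' \<otimes>\<^bsub>YH d m n\<^esub> y)) \<and>
     (\<forall>k\<in>{2..n}. \<forall>u\<in>subYH d m n (k - 1).
        tr (g_elt d m n (k - 1) \<otimes>\<^bsub>YH d m n\<^esub> u) = z * tr u) \<and>
     (\<forall>k\<in>{1..n}. \<forall>u\<in>subYH d m n (k - 1). \<forall>a<m. \<forall>b<d.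
        tr ((Xt_elt d m n k [^]\<^bsub>YH d m n\<^esub> a) \<otimes>\<^bsub>YH d m n\<^esub> (t_elt d m n k [^]\<^bsub>YH d m n\<^esub> b)
              \<otimes>\<^bsub>YH d m n\<^esub> u) = x a b * tr u)"

end

theory Submission
  imports Defs
begin

text \<open>
  Let \<open>N\<^sub>k\<close> be the set of all \<open>z\<close> with \<open>\<tau> (y z t\<^sub>k\<^sub>+\<^sub>1\<^sup>b) = 0\<close> for all \<open>b\<close> and all \<open>y\<close> in the subalgebra
  on \<open>k\<close> strands.  It is a bimodule over that subalgebra and contains \<open>g\<^sub>k\<close> and the powers
  \<open>h\<^sup>-\<^sup>1 X\<^sub>1\<^sup>a h\<close>, \<open>0 < a < m\<close>, of the conjugated Jucys--Murphy element, where \<open>h = g\<^sub>1 \<dots> g\<^sub>k\<close>.  Passing from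
  \<open>j\<close> to \<open>j + 1\<close> with the quadratic relation, one sees that \<open>N\<^sub>k\<close> contains \<open>h\<^sup>-\<^sup>1 X\<^sub>j\<^sup>a h\<close> for
  \<open>h = g\<^sub>j \<dots> g\<^sub>k\<close>, hence finally \<open>X\<^sub>k\<^sub>+\<^sub>1\<^sup>a\<close>, and then also \<open>g\<^sub>k X\<^sub>k\<^sub>+\<^sub>1\<^sup>a\<close>.  Since every reduced
  word is braid equivalent to a product of a word in \<open>s\<^sub>1, \<dots>, s\<^sub>k\<^sub>-\<^sub>1\<close> and a descending word
  \<open>s\<^sub>k \<dots> s\<^sub>i\<close>, the trace of a basis element is computed by induction on the number of strands.
\<close>

section \<open>Reduced words and braid equivalence\<close>

lemma perm_of_word_Nil [simp]: "perm_of_word [] = id"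
  by (simp add: perm_of_word_def)

lemma perm_of_word_Cons [simp]:
  "perm_of_word (i # is) = Transposition.transpose i (i + 1) \<circ> perm_of_word is"
  by (simp add: perm_of_word_def)

lemma perm_of_word_append [simp]:
  "perm_of_word (is @ js) = perm_of_word is \<circ> perm_of_word js"
  by (induction "is") (auto simp: o_assoc)

lemma transpose_adjacent_conj:
  assumes "a < b"
  shows "Transposition.transpose a (Suc b) =
    Transposition.transpose b (b + 1) \<circ> Transposition.transpose a b \<circ> Transposition.transpose b (b + 1)"
  using assms by (auto simp: fun_eq_iff Transposition.transpose_def)

text \<open>Induction on \<open>b\<close>: the transposition of \<open>a\<close> and
  \<open>b + 1\<close> is the conjugate of the one of \<open>a\<close> and \<open>b\<close> by
  \<open>s_b\<close>. The bound on the letters keeps the word inside \<open>{1..<n}\<close>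
  later.\<close>

lemma transpose_eq_perm_of_word:
  assumes "a < b"
  shows "\<exists>is. set is \<subseteq> {a..<b} \<and> perm_of_word is = Transposition.transpose a b"
  using assms
proof (induction b)
  case (Suc b)
  show ?case
  proof (cases "a = b")
    case True
    then show ?thesis by (intro exI[of _ "[b]"]) simp
  next
    case False
    with Suc obtain "is" where "set is \<subseteq> {a..<b}" "perm_of_word is = Transposition.transpose a b"
      by auto
    with False Suc.prems show ?thesis
      by (intro exI[of _ "[b] @ is @ [b]"]) (auto simp: transpose_adjacent_conj o_assoc)
  qed
qed simp

text \<open>Permutation induction builds \<open>w\<close> from arbitrary transpositions, and each of
  these is a word in adjacent ones.\<close>

lemma permutes_eq_perm_of_word:
  assumes "w permutes {1..n}"
  shows "\<exists>is. set is \<subseteq> {1..<n} \<and> perm_of_word is = w"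
  using assms finite_atLeastAtMost
proof (induction rule: permutes_induct)
  case id
  show ?case by (intro exI[of _ "[]"]) simp
next
  case (swap a b p)
  then obtain "is" where "is": "set is \<subseteq> {1..<n}" "perm_of_word is = p" by auto
  have "\<exists>js. set js \<subseteq> {min a b..<max a b} \<and> perm_of_word js = Transposition.transpose a b"
    using transpose_eq_perm_of_word[of a b] transpose_eq_perm_of_word[of b a] swap.hyps
    by (cases a b rule: linorder_cases) (auto simp: transpose_commute min_def max_def)
  then obtain js where js: "set js \<subseteq> {min a b..<max a b}" "perm_of_word js = Transposition.transpose a b"
    by blast
  have "{min a b..<max a b} \<subseteq> {1..<n}" using swap.hyps by auto
  with js(1) have "set js \<subseteq> {1..<n}" by (rule subset_trans)
  with js(2) have "set (js @ is) \<subseteq> {1..<n}" "perm_of_word (js @ is) = Transposition.transpose a b \<circ> p"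
    using "is" by auto
  then show ?case by blast
qed

lemma reduced_expr_SOME:
  assumes "w permutes {1..n}"
  shows "reduced_expr n w (SOME is. reduced_expr n w is)"
proof -
  obtain "is" where "set is \<subseteq> {1..<n} \<and> perm_of_word is = w"
    using permutes_eq_perm_of_word[OF assms] by blast
  then obtain js where "set js \<subseteq> {1..<n} \<and> perm_of_word js = w"
    "\<And>ks. set ks \<subseteq> {1..<n} \<and> perm_of_word ks = w \<Longrightarrow> length js \<le> length ks"
    using ex_has_least_nat[of "\<lambda>is. set is \<subseteq> {1..<n} \<and> perm_of_word is = w" "is" length] by blast
  then have "reduced_expr n w js"
    by (simp add: reduced_expr_def)
  then show ?thesis by (rule someI)
qed

section \<open>Braid moves on words\<close>

text \<open>Equality of words in the braid monoid. Cancelling a square is not a move, so length and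
  set of letters are kept, and products of elements satisfying the braid relations depend only on
  the class of the word.\<close>

inductive braid_eq :: "nat list \<Rightarrow> nat list \<Rightarrow> bool" where
  refl [intro!]: "braid_eq is is"
| sym: "braid_eq is js \<Longrightarrow> braid_eq js is"
| trans [trans]: "braid_eq is js \<Longrightarrow> braid_eq js ks \<Longrightarrow> braid_eq is ks"
| far: "i + 1 < j \<Longrightarrow> braid_eq (us @ [i, j] @ vs) (us @ [j, i] @ vs)"
| braid: "braid_eq (us @ [i, i + 1, i] @ vs) (us @ [i + 1, i, i + 1] @ vs)"

lemma braid_eq_context:
  "braid_eq is js \<Longrightarrow> braid_eq (us @ is @ vs) (us @ js @ vs)"
proof (induction rule: braid_eq.induct)
  case (far i j us' vs')
  then show ?case
    using braid_eq.far[of i j "us @ us'" "vs' @ vs"] by simp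
next
  case (braid us' i vs')
  then show ?case
    using braid_eq.braid[of "us @ us'" i "vs' @ vs"] by simp
qed (blast intro: braid_eq.intros)+

lemma braid_eq_length: "braid_eq is js \<Longrightarrow> length is = length js"
  by (induction rule: braid_eq.induct) auto

lemma braid_eq_set: "braid_eq is js \<Longrightarrow> set is = set js"
  by (induction rule: braid_eq.induct) auto

lemma braid_eq_perm: "braid_eq is js \<Longrightarrow> perm_of_word is = perm_of_word js"
proof (induction rule: braid_eq.induct)
  case (far i j us vs)
  then have "perm_of_word [i, j] = perm_of_word [j, i]"
    by (auto simp: fun_eq_iff Transposition.transpose_def)
  then show ?case by (metis perm_of_word_append)
next
  case (braid us i vs)
  have "perm_of_word [i, i + 1, i] = perm_of_word [i + 1, i, i + 1]"
    by (auto simp: fun_eq_iff Transposition.transpose_def)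
  then show ?case by (metis perm_of_word_append)
qed auto

lemma braid_eq_commute:
  assumes "\<forall>j\<in>set is. j + 1 < k \<or> k + 1 < j"
  shows "braid_eq (is @ [k]) (k # is)"
  using assms
proof (induction "is")
  case (Cons j "is")
  have "braid_eq ([j] @ (is @ [k]) @ []) ([j] @ (k # is) @ [])"
    using Cons by (intro braid_eq_context) auto
  also have "braid_eq ([j] @ (k # is) @ []) (k # j # is)"
    using Cons.prems braid_eq.far[of j k "[]" "is"] braid_eq.far[of k j "[]" "is"]
    by (auto intro: braid_eq.sym)
  finally show ?case by simp
qed auto

text \<open>Split the descending word at \<open>k\<close> and \<open>l = k - 1\<close>. The new
  letter commutes past the smaller letters and meets \<open>k, l\<close>; after a braid move the
  leading \<open>l\<close> commutes past the larger letters.\<close>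

lemma braid_eq_descending:
  assumes "i < k" "k < n"
  shows "braid_eq (rev [i..<n] @ [k]) ((k - 1) # rev [i..<n])"
proof -
  obtain l where l: "k = Suc l" "i \<le> l" using assms by (cases k) auto
  let ?U = "rev [Suc k..<n]" and ?V = "rev [i..<l]"
  have "[i..<n] = [i..<l] @ [l..<n]"
    using assms l by (metis le_add_diff_inverse less_imp_le_nat upt_add_eq_append Suc_lessD)
  also have "[l..<n] = l # k # [Suc k..<n]"
    using assms l by (simp add: upt_conv_Cons)
  finally have D: "rev [i..<n] = ?U @ [k, l] @ ?V" by simp
  have "braid_eq ((?U @ [k, l]) @ (?V @ [k]) @ []) ((?U @ [k, l]) @ (k # ?V) @ [])"
    using l by (intro braid_eq_context braid_eq_commute) auto
  also have "braid_eq ((?U @ [k, l]) @ (k # ?V) @ []) (?U @ [l, k, l] @ ?V)"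
    using braid_eq.braid[of ?U l ?V] l by (auto intro: braid_eq.sym)
  also have "braid_eq (?U @ [l, k, l] @ ?V) ([] @ (l # ?U) @ ([k, l] @ ?V))"
    using braid_eq_context[of "?U @ [l]" "l # ?U" "[]" "[k, l] @ ?V"] l braid_eq_commute[of ?U l]
    by auto
  finally show ?thesis using D l by simp
qed

lemma braid_eq_rev: "braid_eq is js \<Longrightarrow> braid_eq (rev is) (rev js)"
proof (induction rule: braid_eq.induct)
  case (far i j us vs)
  then show ?case
    using braid_eq.far[of i j "rev vs" "rev us"] by (auto intro: braid_eq.sym)
next
  case (braid us i vs)
  then show ?case
    using braid_eq.braid[of "rev vs" i "rev us"] by simp
qed (blast intro: braid_eq.intros)+

text \<open>By the reversal of \<open>braid_eq_descending\<close>, a letter passing to the left of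
  an ascending word is raised by one; induction on \<open>l\<close> treats the letters in turn. This
  is the relation behind \<open>conj_g_null\<close>.\<close>

lemma braid_eq_ascending:
  assumes "l < n"
  shows "braid_eq ([i..<n] @ [i..<l]) ([Suc i..<Suc l] @ [i..<n])"
  using assms
proof (induction l)
  case (Suc l)
  show ?case
  proof (cases "i \<le> l")
    case True
    have "braid_eq ([i..<n] @ [l]) (Suc l # [i..<n])"
      using braid_eq_rev[OF braid_eq_descending[of i "Suc l" n]] True Suc.prems
      by (auto intro: braid_eq.sym)
    then have "braid_eq ([Suc i..<Suc l] @ [i..<n] @ [l]) ([Suc i..<Suc l] @ (Suc l # [i..<n]))"
      using braid_eq_context[of _ _ "[Suc i..<Suc l]" "[]"] by simp
    moreover have "braid_eq (([i..<n] @ [i..<l]) @ [l]) (([Suc i..<Suc l] @ [i..<n]) @ [l])"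
      using Suc braid_eq_context[of "[i..<n] @ [i..<l]" "[Suc i..<Suc l] @ [i..<n]" "[]" "[l]"] by simp
    ultimately show ?thesis
      using True by (auto intro: braid_eq.trans)
  qed auto
qed auto

section \<open>Normal words along the chain of symmetric groups\<close>

text \<open>The descending words \<open>k, ..., i\<close> represent the right cosets of the
  symmetric group on \<open>k\<close> points in the one on \<open>k + 1\<close> points;
  \<open>i = Suc k\<close> gives the empty word.\<close>

inductive normal_word :: "nat \<Rightarrow> nat list \<Rightarrow> bool" where
  zero: "normal_word 0 []"
| Suc: "normal_word k us \<Longrightarrow> 1 \<le> i \<Longrightarrow> i \<le> Suc k \<Longrightarrow> normal_word (Suc k) (us @ rev [i..<Suc k])"

lemma normal_word_set: "normal_word k us \<Longrightarrow> set us \<subseteq> {1..<k}"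
  by (induction rule: normal_word.induct) auto

lemma normal_word_Nil: "normal_word k []"
proof (induction k)
  case (Suc k)
  then show ?case using normal_word.Suc[of k "[]" "Suc k"] by simp
qed (rule normal_word.zero)

text \<open>Inductive step of the normal form: the new letter is absorbed by braid moves, unless a
  cancellation exhibits a shorter word for the same permutation.\<close>

lemma normal_word_snoc:
  assumes "normal_word n us" "1 \<le> k" "k < n"
  shows "(\<exists>vs. normal_word n vs \<and> braid_eq (us @ [k]) vs) \<or>
    (\<exists>js. set js \<subseteq> {1..<n} \<and> length js < length (us @ [k]) \<and> perm_of_word js = perm_of_word (us @ [k]))"
  using assms
proof (induction arbitrary: k rule: normal_word.induct)
  case (Suc n us i)
  let ?D = "rev [i..<Suc n]"
  \<comment> \<open>Once the letter has passed to the left of the descending factor as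
    \<open>l\<close>, the induction hypothesis treats \<open>us @ [l]\<close>, and either
    alternative survives appending that factor.\<close>
  have move: ?case if l: "1 \<le> l" "l < n" and eq: "braid_eq (?D @ [k]) (l # ?D)" for l
  proof -
    have eq': "braid_eq ((us @ ?D) @ [k]) ((us @ [l]) @ ?D)"
      using braid_eq_context[OF eq, of us "[]"] by simp
    consider vs where "normal_word n vs" "braid_eq (us @ [l]) vs"
      | js where "set js \<subseteq> {1..<n}" "length js < length (us @ [l])"
        "perm_of_word js = perm_of_word (us @ [l])"
      using Suc.IH[OF l] by blast
    then show ?thesis
    proof cases
      case 1
      have "braid_eq ((us @ ?D) @ [k]) (vs @ ?D)"
        using eq' braid_eq_context[OF 1(2), of "[]" ?D] by (auto intro: braid_eq.trans)
      moreover have "normal_word (Suc n) (vs @ ?D)"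
        using 1 Suc.hyps by (intro normal_word.Suc)
      ultimately show ?thesis by blast
    next
      case 2
      have "perm_of_word (js @ ?D) = perm_of_word ((us @ ?D) @ [k])"
        using braid_eq_perm[OF eq'] 2(3) by (simp only: perm_of_word_append)
      moreover have "set (js @ ?D) \<subseteq> {1..<Suc n}" using 2(1) Suc.hyps by auto
      moreover have "length (js @ ?D) < length ((us @ ?D) @ [k])" using 2(2) by simp
      ultimately show ?thesis by blast
    qed
  qed
  \<comment> \<open>In this order the letter commutes with the descending factor, prolongs it,
    cancels its last letter \<open>i\<close>, or passes through it as \<open>k - 1\<close>.\<close>
  consider "k + 1 < i" | "k + 1 = i" | "k = i" | "i < k" by linarith
  then show ?case
  proof cases
    case 1
    then have "\<forall>j\<in>set ?D. j + 1 < k \<or> k + 1 < j" by auto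
    with 1 Suc show ?thesis by (intro move[of k] braid_eq_commute) auto
  next
    case 2
    have "normal_word (Suc n) (us @ rev [k..<Suc n])"
      using Suc by (intro normal_word.Suc) auto
    moreover have "rev [k..<Suc n] = ?D @ [k]"
      using 2 Suc.prems by (simp add: upt_conv_Cons del: upt_Suc)
    ultimately show ?thesis by auto
  next
    case 3
    have "?D = rev [Suc i..<Suc n] @ [k]"
      using 3 Suc.prems by (simp add: upt_conv_Cons del: upt_Suc)
    then have "length (us @ rev [Suc i..<Suc n]) < length ((us @ ?D) @ [k])"
      "perm_of_word (us @ rev [Suc i..<Suc n]) = perm_of_word ((us @ ?D) @ [k])"
      by (auto simp add: fun_eq_iff simp del: upt_Suc)
    moreover have "set (us @ rev [Suc i..<Suc n]) \<subseteq> {1..<Suc n}"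
      using normal_word_set[OF Suc.hyps(1)] by (auto simp del: upt_Suc)
    ultimately show ?thesis by blast
  next
    case 4
    with Suc show ?thesis by (intro move[of "k - 1"] braid_eq_descending) auto
  qed
qed simp

text \<open>Letters are appended one at a time with \<open>normal_word_snoc\<close>; a word whose
  prefix can be shortened can itself be shortened.\<close>

lemma word_normal_or_not_reduced:
  assumes "set is \<subseteq> {1..<n}"
  shows "(\<exists>vs. normal_word n vs \<and> braid_eq is vs) \<or>
    (\<exists>js. set js \<subseteq> {1..<n} \<and> length js < length is \<and> perm_of_word js = perm_of_word is)"
  using assms
proof (induction "is" rule: rev_induct)
  case Nil
  then show ?case using normal_word_Nil by blast
next
  case (snoc k "is")
  then consider vs where "normal_word n vs" "braid_eq is vs"
    | js where "set js \<subseteq> {1..<n}" "length js < length is" "perm_of_word js = perm_of_word is"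
    by auto
  then show ?case
  proof cases
    case 1
    have eq: "braid_eq (is @ [k]) (vs @ [k])"
      using braid_eq_context[OF 1(2), of "[]" "[k]"] by simp
    have "1 \<le> k" "k < n" using snoc.prems by auto
    from normal_word_snoc[OF 1(1) this] show ?thesis
      using braid_eq_length[OF eq] braid_eq_perm[OF eq] eq by (metis braid_eq.trans)
  next
    case 2
    then show ?thesis using snoc.prems
      by (intro disjI2 exI[of _ "js @ [k]"]) auto
  qed
qed

text \<open>Minimal length excludes the second alternative of
  \<open>word_normal_or_not_reduced\<close>. Braid moves preserve length, so emptiness of the normal
  word still detects the identity.\<close>

lemma reduced_expr_normal:
  assumes "reduced_expr n w is"
  obtains vs where "normal_word n vs" "braid_eq is vs" "vs = [] \<longleftrightarrow> w = id"
proof -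
  obtain vs where vs: "normal_word n vs" "braid_eq is vs"
    using assms word_normal_or_not_reduced[of "is" n] unfolding reduced_expr_def
    by (meson not_le)
  have "is = [] \<longleftrightarrow> w = id"
    using assms unfolding reduced_expr_def by (auto dest: spec[of _ "[]"])
  then have "vs = [] \<longleftrightarrow> w = id"
    using braid_eq_length[OF vs(2)] by auto
  with vs show thesis by (rule that)
qed

section \<open>Words in a Yokonuma--Hecke algebra\<close>

lemma lprod_simps [simp]:
  "lprod A [] = one A"
  "lprod A (x # xs) = mult A x (lprod A xs)"
  by (simp_all add: lprod_def)

context ring
begin

lemma lprod_closed [intro]: "set xs \<subseteq> carrier R \<Longrightarrow> lprod R xs \<in> carrier R"
  by (induction xs) auto

lemma lprod_append:
  "set xs \<subseteq> carrier R \<Longrightarrow> set ys \<subseteq> carrier R \<Longrightarrow> lprod R (xs @ ys) = lprod R xs \<otimes> lprod R ys"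
  by (induction xs) (auto simp: m_assoc lprod_closed)

lemma lprod_subring: "subring K R \<Longrightarrow> set xs \<subseteq> K \<Longrightarrow> lprod R xs \<in> K"
  by (induction xs) (auto intro: subringE)

lemma nat_pow_subring: "subring K R \<Longrightarrow> x \<in> K \<Longrightarrow> x [^] (i :: nat) \<in> K"
  by (induction i) (auto intro: subringE)

text \<open>Commutation is expressed as membership in a subring, so that it passes from generators
  to everything they generate.\<close>

definition centralizer :: "'a \<Rightarrow> 'a set" where
  "centralizer y = {x \<in> carrier R. x \<otimes> y = y \<otimes> x}"

lemma centralizerI: "x \<in> carrier R \<Longrightarrow> x \<otimes> y = y \<otimes> x \<Longrightarrow> x \<in> centralizer y"
  by (simp add: centralizer_def)

lemma centralizer_sym: "x \<in> centralizer y \<Longrightarrow> y \<in> carrier R \<Longrightarrow> y \<in> centralizer x"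
  by (simp add: centralizer_def)

lemma centralizer_self: "x \<in> carrier R \<Longrightarrow> x \<in> centralizer x"
  by (simp add: centralizer_def)

lemma centralizer_closed: "x \<in> centralizer y \<Longrightarrow> x \<in> carrier R"
  by (simp add: centralizer_def)

lemma centralizerD: "x \<in> centralizer y \<Longrightarrow> x \<otimes> y = y \<otimes> x"
  by (simp add: centralizer_def)

lemma centralizerD':
  "x \<in> centralizer y \<Longrightarrow> y \<in> carrier R \<Longrightarrow> z \<in> carrier R \<Longrightarrow> x \<otimes> (y \<otimes> z) = y \<otimes> (x \<otimes> z)"
  by (metis centralizer_closed centralizerD m_assoc)

lemma centralizer_subring: "y \<in> carrier R \<Longrightarrow> subring (centralizer y) R"
proof (rule subringI)
  fix a b assume "y \<in> carrier R" "a \<in> centralizer y" "b \<in> centralizer y"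
  then show "a \<otimes> b \<in> centralizer y"
    by (auto simp: centralizer_def) (metis m_assoc)
qed (auto simp: centralizer_def l_distr r_distr l_minus r_minus)

lemma centralizer_mult:
  "a \<in> centralizer y \<Longrightarrow> b \<in> centralizer y \<Longrightarrow> y \<in> carrier R \<Longrightarrow> a \<otimes> b \<in> centralizer y"
  using subringE(6)[OF centralizer_subring] by blast

lemma centralizer_pow:
  "a \<in> centralizer y \<Longrightarrow> y \<in> carrier R \<Longrightarrow> a [^] (i :: nat) \<in> centralizer y"
  by (intro nat_pow_subring centralizer_subring)

lemma generate_ring_centralizer:
  "z \<in> generate_ring R H \<Longrightarrow> H \<subseteq> centralizer y \<Longrightarrow> y \<in> carrier R \<Longrightarrow> z \<in> centralizer y"
  using generate_ring_min_subring1[of H "centralizer y"] centralizer_subring[of y]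
  by (auto dest: centralizer_closed)

lemma centralizer_inverse:
  assumes "x \<in> centralizer y" "x' \<in> carrier R" "y \<in> carrier R" "x \<otimes> x' = \<one>" "x' \<otimes> x = \<one>"
  shows "x' \<in> centralizer y"
proof -
  have x: "x \<in> carrier R" using assms(1) by (rule centralizer_closed)
  have "x' \<otimes> y = x' \<otimes> (y \<otimes> (x \<otimes> x'))" using assms by simp
  also have "\<dots> = x' \<otimes> (x \<otimes> (y \<otimes> x'))" using centralizerD'[OF assms(1,3,2)] by simp
  also have "\<dots> = (x' \<otimes> x) \<otimes> (y \<otimes> x')" using assms(2,3) x by (simp add: m_assoc)
  also have "\<dots> = y \<otimes> x'" using assms by simp
  finally show ?thesis using assms by (intro centralizerI)
qed

lemma inv_mult_Units:
  assumes "x \<in> Units R" "y \<in> Units R"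
  shows "inv (x \<otimes> y) = inv y \<otimes> inv x"
proof -
  have [simp]: "x \<in> carrier R" "y \<in> carrier R" using assms by auto
  have "(x \<otimes> y) \<otimes> (inv y \<otimes> inv x) = x \<otimes> ((y \<otimes> inv y) \<otimes> inv x)"
    "(inv y \<otimes> inv x) \<otimes> (x \<otimes> y) = inv y \<otimes> ((inv x \<otimes> x) \<otimes> y)"
    using assms by (auto simp del: Units_r_inv Units_l_inv simp: m_assoc)
  then have "inv y \<otimes> inv x = inv (x \<otimes> y)"
    using assms by (intro inv_unique') auto
  then show ?thesis ..
qed

text \<open>For a fixed unit \<open>p\<close> this is a ring automorphism; as the inverse stands on
  the left, composition reverses the order of the factors in \<open>conj_conj\<close>.\<close>

definition conj :: "'a \<Rightarrow> 'a \<Rightarrow> 'a" where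
  "conj p z = inv p \<otimes> z \<otimes> p"

lemma conj_closed [simp]: "p \<in> Units R \<Longrightarrow> z \<in> carrier R \<Longrightarrow> conj p z \<in> carrier R"
  by (auto simp: conj_def)

lemma conj_one [simp]: "p \<in> Units R \<Longrightarrow> conj p \<one> = \<one>"
  by (auto simp: conj_def)

lemma conj_cancel:
  assumes "p \<in> Units R" "y \<in> carrier R"
  shows "p \<otimes> (inv p \<otimes> y) = y" "inv p \<otimes> (p \<otimes> y) = y"
  using assms by (simp_all add: m_assoc[symmetric] Units_closed)

lemma conj_mult:
  "p \<in> Units R \<Longrightarrow> y \<in> carrier R \<Longrightarrow> z \<in> carrier R \<Longrightarrow> conj p (y \<otimes> z) = conj p y \<otimes> conj p z"
  by (simp add: conj_def m_assoc Units_closed conj_cancel)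

lemma conj_add:
  "p \<in> Units R \<Longrightarrow> y \<in> carrier R \<Longrightarrow> z \<in> carrier R \<Longrightarrow> conj p (y \<oplus> z) = conj p y \<oplus> conj p z"
  by (simp add: conj_def Units_closed r_distr l_distr)

lemma conj_neg:
  "p \<in> Units R \<Longrightarrow> y \<in> carrier R \<Longrightarrow> conj p (\<ominus> y) = \<ominus> conj p y"
  by (simp add: conj_def Units_closed r_minus l_minus)

lemma conj_pow:
  "p \<in> Units R \<Longrightarrow> y \<in> carrier R \<Longrightarrow> conj p (y [^] (i::nat)) = conj p y [^] i"
  by (induction i) (auto simp: conj_mult)

lemma conj_commuting: "p \<in> Units R \<Longrightarrow> p \<in> centralizer y \<Longrightarrow> y \<in> carrier R \<Longrightarrow> conj p y = y"
  by (simp add: conj_def m_assoc conj_cancel centralizerD[symmetric] Units_closed)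

lemma conj_conj:
  "p \<in> Units R \<Longrightarrow> r \<in> Units R \<Longrightarrow> y \<in> carrier R \<Longrightarrow> conj p (conj r y) = conj (r \<otimes> p) y"
  by (simp add: conj_def m_assoc inv_mult_Units Units_closed)

end

text \<open>An abstract ring with the relations of the algebra, so that the computations avoid
  cosets. \<open>S\<close> holds the scalars, \<open>Xi\<close> is the inverse of
  \<open>X_1\<close>, and \<open>E i\<close> stands for \<open>(q - q^-1) e_i\<close>, known through
  its generators, its commutation with \<open>g i\<close> and the quadratic relation.\<close>

locale yokonuma_hecke = ring A for A (structure) +
  fixes n d :: nat and g t X Xt E :: "nat \<Rightarrow> 'a" and Xi :: 'a and S :: "'a set"
  assumes S_closed: "S \<subseteq> carrier A"
    and S_central: "\<And>s y. s \<in> S \<Longrightarrow> y \<in> carrier A \<Longrightarrow> s \<otimes> y = y \<otimes> s"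
    and d_pos: "0 < d"
    and g_closed [simp]: "\<And>i. 1 \<le> i \<Longrightarrow> i < n \<Longrightarrow> g i \<in> carrier A"
    and t_closed [simp]: "\<And>i. 1 \<le> i \<Longrightarrow> i \<le> n \<Longrightarrow> t i \<in> carrier A"
    and X1_closed [simp]: "X (Suc 0) \<in> carrier A"
    and Xi_closed [simp]: "Xi \<in> carrier A"
    and X1_Xi: "X (Suc 0) \<otimes> Xi = \<one>" "Xi \<otimes> X (Suc 0) = \<one>"
    and X_Suc: "\<And>j. 1 \<le> j \<Longrightarrow> X (Suc j) = g j \<otimes> X j \<otimes> g j"
    and Xt_1: "Xt (Suc 0) = X (Suc 0)"
    and Xt_Suc: "\<And>j. 1 \<le> j \<Longrightarrow> Xt (Suc j) = inv (g j) \<otimes> Xt j \<otimes> g j"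
    and g_far: "\<And>i j. 1 \<le> i \<Longrightarrow> i + 1 < j \<Longrightarrow> j < n \<Longrightarrow> g i \<otimes> g j = g j \<otimes> g i"
    and g_braid: "\<And>i. 1 \<le> i \<Longrightarrow> i + 1 < n \<Longrightarrow>
      g i \<otimes> g (i + 1) \<otimes> g i = g (i + 1) \<otimes> g i \<otimes> g (i + 1)"
    and t_t: "\<And>i j. 1 \<le> i \<Longrightarrow> i \<le> n \<Longrightarrow> 1 \<le> j \<Longrightarrow> j \<le> n \<Longrightarrow> t i \<otimes> t j = t j \<otimes> t i"
    and t_g: "\<And>i j. 1 \<le> i \<Longrightarrow> i < n \<Longrightarrow> 1 \<le> j \<Longrightarrow> j \<le> n \<Longrightarrow>
      t j \<otimes> g i = g i \<otimes> t (Transposition.transpose i (Suc i) j)"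
    and t_pow: "\<And>j. 1 \<le> j \<Longrightarrow> j \<le> n \<Longrightarrow> t j [^] d = \<one>"
    and X1_g1: "2 \<le> n \<Longrightarrow> X (Suc 0) \<otimes> g 1 \<otimes> X (Suc 0) \<otimes> g 1 = g 1 \<otimes> X (Suc 0) \<otimes> g 1 \<otimes> X (Suc 0)"
    and X1_g: "\<And>i. 2 \<le> i \<Longrightarrow> i < n \<Longrightarrow> X (Suc 0) \<otimes> g i = g i \<otimes> X (Suc 0)"
    and X1_t: "\<And>i. 1 \<le> i \<Longrightarrow> i \<le> n \<Longrightarrow> X (Suc 0) \<otimes> t i = t i \<otimes> X (Suc 0)"
    and E_gen: "\<And>i. 1 \<le> i \<Longrightarrow> i < n \<Longrightarrow> E i \<in> generate_ring A (S \<union> {t i, t (Suc i)})"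
    and E_g: "\<And>i. 1 \<le> i \<Longrightarrow> i < n \<Longrightarrow> E i \<otimes> g i = g i \<otimes> E i"
    and g_sq: "\<And>i. 1 \<le> i \<Longrightarrow> i < n \<Longrightarrow> g i \<otimes> g i = \<one> \<oplus> E i \<otimes> g i"
begin

section \<open>Commutation rules for \<open>g\<close>, \<open>t\<close> and \<open>X\<close>\<close>

lemma S_centralizer: "y \<in> carrier A \<Longrightarrow> S \<subseteq> centralizer y"
  using S_closed S_central by (auto simp: centralizer_def)

lemma E_centralizer:
  "1 \<le> i \<Longrightarrow> i < n \<Longrightarrow> y \<in> carrier A \<Longrightarrow> t i \<in> centralizer y \<Longrightarrow> t (Suc i) \<in> centralizer y \<Longrightarrow>
    E i \<in> centralizer y"
  by (rule generate_ring_centralizer[OF E_gen]) (use S_centralizer[of y] in auto)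

lemma E_closed [simp]: "1 \<le> i \<Longrightarrow> i < n \<Longrightarrow> E i \<in> carrier A"
  using E_gen[of i] generate_ring_in_carrier[of "S \<union> {t i, t (Suc i)}"] S_closed by auto

lemma g_cent_g:
  "1 \<le> i \<Longrightarrow> i < n \<Longrightarrow> 1 \<le> j \<Longrightarrow> j < n \<Longrightarrow> i + 1 < j \<or> j + 1 < i \<Longrightarrow> g i \<in> centralizer (g j)"
  using g_far[of i j] g_far[of j i] by (intro centralizerI) auto

lemma t_cent_t:
  "1 \<le> i \<Longrightarrow> i \<le> n \<Longrightarrow> 1 \<le> j \<Longrightarrow> j \<le> n \<Longrightarrow> t i \<in> centralizer (t j)"
  using t_t by (intro centralizerI) auto

lemma t_cent_g:
  "1 \<le> i \<Longrightarrow> i < n \<Longrightarrow> 1 \<le> j \<Longrightarrow> j \<le> n \<Longrightarrow> j \<noteq> i \<Longrightarrow> j \<noteq> Suc i \<Longrightarrow> t j \<in> centralizer (g i)"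
  using t_g[of i j] by (intro centralizerI) (auto simp: Transposition.transpose_def)

lemma t_g_swap:
  assumes "1 \<le> i" "i < n"
  shows "t i \<otimes> g i = g i \<otimes> t (Suc i)" "t (Suc i) \<otimes> g i = g i \<otimes> t i"
  using t_g[of i i] t_g[of i "Suc i"] assms by (auto simp: Transposition.transpose_def)

lemma X_closed [simp]: "1 \<le> j \<Longrightarrow> j \<le> n \<Longrightarrow> X j \<in> carrier A"
proof (induction j rule: dec_induct)
  case (step j)
  then show ?case by (simp add: X_Suc)
qed simp

text \<open>In \<open>X (Suc j) = g j X j g j\<close>, passing the two factors \<open>g j\<close>
  applies \<open>s_j\<close> twice to the index of \<open>t i\<close>; the induction hypothesis is
  needed at the index \<open>s_j i\<close> in between.\<close>

lemma X_cent_t: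
  "1 \<le> j \<Longrightarrow> j \<le> n \<Longrightarrow> 1 \<le> i \<Longrightarrow> i \<le> n \<Longrightarrow> X j \<in> centralizer (t i)"
proof (induction j arbitrary: i rule: dec_induct)
  case base
  then show ?case by (intro centralizerI) (auto simp: X1_t)
next
  case (step j)
  let ?s = "Transposition.transpose j (Suc j)"
  have s: "1 \<le> ?s i" "?s i \<le> n" "?s (?s i) = i"
    using step by (auto simp: Transposition.transpose_def)
  have IH: "X j \<in> centralizer (t (?s i))"
    using step s by (intro step.IH) auto
  have "t i \<otimes> X (Suc j) = (t i \<otimes> g j) \<otimes> X j \<otimes> g j"
    using step by (simp add: X_Suc m_assoc)
  also have "\<dots> = g j \<otimes> (t (?s i) \<otimes> X j) \<otimes> g j"
    using step s t_g[of j i] by (simp add: m_assoc)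
  also have "\<dots> = g j \<otimes> X j \<otimes> (t (?s i) \<otimes> g j)"
    using step s by (simp add: centralizerD'[OF IH] m_assoc)
  also have "\<dots> = X (Suc j) \<otimes> t i"
    using step s t_g[of j "?s i"] by (simp add: X_Suc m_assoc)
  finally show ?case using step by (intro centralizerI) auto
qed

lemma g_cent_X_greater:
  "1 \<le> j \<Longrightarrow> j < i \<Longrightarrow> i < n \<Longrightarrow> g i \<in> centralizer (X j)"
proof (induction j rule: dec_induct)
  case base
  then show ?case by (intro centralizerI) (auto simp: X1_g)
next
  case (step j)
  then have "X j \<in> centralizer (g i)" "g j \<in> centralizer (g i)"
    using g_cent_g[of j i] by (auto intro!: centralizer_sym[of "g i"])
  then show ?case
    using step by (auto simp: X_Suc intro!: centralizer_sym[of _ "g i"] centralizer_mult)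
qed

text \<open>For \<open>j = i + 1\<close>, a braid relation turns \<open>g i\<close> into
  \<open>g (i+1)\<close> in front of \<open>X i\<close>, which it passes, and a second one turns it
  back. For larger \<open>j\<close> the additional factors \<open>g\<close> commute with
  \<open>g i\<close>.\<close>

lemma g_cent_X_less:
  "Suc i \<le> j \<Longrightarrow> 1 \<le> i \<Longrightarrow> Suc j \<le> n \<Longrightarrow> g i \<in> centralizer (X (Suc j))"
proof (induction j rule: dec_induct)
  case base
  have [simp]: "g i \<in> carrier A" "g (Suc i) \<in> carrier A" "X i \<in> carrier A" using base by auto
  have br: "g i \<otimes> (g (Suc i) \<otimes> g i) = g (Suc i) \<otimes> (g i \<otimes> g (Suc i))"
    using g_braid[of i] base by (simp add: m_assoc)
  have br': "g i \<otimes> (g (Suc i) \<otimes> (g i \<otimes> z)) = g (Suc i) \<otimes> (g i \<otimes> (g (Suc i) \<otimes> z))"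
    if "z \<in> carrier A" for z using br that by (metis \<open>g i \<in> _\<close> \<open>g (Suc i) \<in> _\<close> m_assoc m_closed)
  have c: "g (Suc i) \<otimes> (X i \<otimes> z) = X i \<otimes> (g (Suc i) \<otimes> z)" if "z \<in> carrier A" for z
    using base that by (intro centralizerD' g_cent_X_greater) auto
  have "g i \<otimes> X (Suc (Suc i)) = X (Suc (Suc i)) \<otimes> g i"
    using base by (simp add: X_Suc m_assoc br' c br)
  then show ?case using base by (intro centralizerI) auto
next
  case (step j)
  then have "X (Suc j) \<in> centralizer (g i)" "g (Suc j) \<in> centralizer (g i)"
    using g_cent_g[of "Suc j" i] by (auto intro!: centralizer_sym[of "g i"])
  then show ?case
    using step by (auto simp: X_Suc[of "Suc j"] intro!: centralizer_sym[of _ "g i"] centralizer_mult)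
qed

text \<open>For \<open>X 2\<close> this is the defining relation between \<open>X_1\<close> and
  \<open>g 1\<close>; the later factors \<open>g j\<close>, \<open>2 <= j\<close>, commute with
  \<open>X_1\<close>.\<close>

lemma X1_cent_X:
  "1 \<le> j \<Longrightarrow> j \<le> n \<Longrightarrow> X (Suc 0) \<in> centralizer (X j)"
proof (induction j rule: dec_induct)
  case base
  then show ?case by (simp add: centralizer_self)
next
  case (step j)
  show ?case
  proof (cases "j = 1")
    case True
    then show ?thesis
      using step X1_g1 by (intro centralizerI) (auto simp: X_Suc[of "Suc 0"] m_assoc)
  next
    case False
    then have "X j \<in> centralizer (X (Suc 0))" "g j \<in> centralizer (X (Suc 0))"
      using step g_cent_X_greater[of 1 j] by (auto intro!: centralizer_sym[of "X (Suc 0)"])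
    then show ?thesis
      using step by (auto simp: X_Suc intro!: centralizer_sym[of _ "X (Suc 0)"] centralizer_mult)
  qed
qed

section \<open>Subalgebras on fewer strands\<close>

definition sub_gens :: "nat \<Rightarrow> 'a set" where
  "sub_gens k = S \<union> (if k = 0 then {} else t ` {1..k} \<union> g ` {1..<k} \<union> {X (Suc 0), Xi})"

definition sub :: "nat \<Rightarrow> 'a set" where
  "sub k = generate_ring A (sub_gens k)"

lemma sub_gens_closed: "k \<le> n \<Longrightarrow> sub_gens k \<subseteq> carrier A"
  using S_closed by (auto simp: sub_gens_def)

lemma sub_subring: "k \<le> n \<Longrightarrow> subring (sub k) A"
  unfolding sub_def by (intro generate_ring_is_subring sub_gens_closed)

lemma sub_closed: "y \<in> sub k \<Longrightarrow> k \<le> n \<Longrightarrow> y \<in> carrier A"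
  using subringE(1)[OF sub_subring] by blast

lemma sub_mult: "k \<le> n \<Longrightarrow> x \<in> sub k \<Longrightarrow> y \<in> sub k \<Longrightarrow> x \<otimes> y \<in> sub k"
  using subringE(6)[OF sub_subring] by blast

lemma S_sub: "s \<in> S \<Longrightarrow> s \<in> sub k"
  unfolding sub_def by (rule generate_ring.incl) (auto simp: sub_gens_def)

lemma t_sub: "1 \<le> i \<Longrightarrow> i \<le> k \<Longrightarrow> t i \<in> sub k"
  unfolding sub_def by (rule generate_ring.incl) (auto simp: sub_gens_def)

lemma g_sub: "1 \<le> i \<Longrightarrow> i < k \<Longrightarrow> g i \<in> sub k"
  unfolding sub_def by (rule generate_ring.incl) (auto simp: sub_gens_def)

lemma X_sub: "1 \<le> j \<Longrightarrow> j \<le> k \<Longrightarrow> k \<le> n \<Longrightarrow> X j \<in> sub k"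
proof (induction j rule: dec_induct)
  case base
  then show ?case
    unfolding sub_def by (intro generate_ring.incl) (auto simp: sub_gens_def)
next
  case (step j)
  then show ?case by (auto simp: X_Suc intro!: sub_mult g_sub)
qed

lemma E_sub: "1 \<le> i \<Longrightarrow> i < k \<Longrightarrow> k \<le> n \<Longrightarrow> E i \<in> sub k"
  using generate_ring_min_subring1[OF _ sub_subring, of "S \<union> {t i, t (Suc i)}" k] S_closed
    E_gen[of i] S_sub[of _ k] t_sub[of i k] t_sub[of "Suc i" k] by auto

text \<open>Centralizers being subrings, the generators suffice; \<open>Xi\<close> inherits the
  property from \<open>X_1\<close>. Mutual commutation of neighbouring \<open>X j\<close> is a
  special case.\<close>

lemma sub_cent:
  assumes "k < n" "y \<in> sub k"
  shows "y \<in> centralizer (X (Suc k))" "y \<in> centralizer (t (Suc k))"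
proof -
  have "sub_gens k \<subseteq> centralizer (X (Suc k))"
  proof -
    have "X (Suc 0) \<in> centralizer (X (Suc k))"
      using assms X1_cent_X by auto
    moreover from this have "Xi \<in> centralizer (X (Suc k))"
      using assms by (rule_tac centralizer_inverse[OF _ _ _ X1_Xi]) auto
    moreover have "t i \<in> centralizer (X (Suc k))" if "1 \<le> i" "i \<le> k" for i
      using that assms X_cent_t[of "Suc k" i] by (auto intro!: centralizer_sym[of "X (Suc k)"])
    moreover have "g i \<in> centralizer (X (Suc k))" if "1 \<le> i" "i < k" for i
      using that assms g_cent_X_less[of i k] by auto
    ultimately show ?thesis
      using S_centralizer[of "X (Suc k)"] assms by (auto simp: sub_gens_def)
  qed
  then show "y \<in> centralizer (X (Suc k))"
    using assms(1,2) unfolding sub_def by (intro generate_ring_centralizer) auto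
  have "sub_gens k \<subseteq> centralizer (t (Suc k))"
  proof -
    have "X (Suc 0) \<in> centralizer (t (Suc k))"
      using assms X_cent_t by auto
    moreover from this have "Xi \<in> centralizer (t (Suc k))"
      using assms by (rule_tac centralizer_inverse[OF _ _ _ X1_Xi]) auto
    moreover have "t i \<in> centralizer (t (Suc k))" if "1 \<le> i" "i \<le> k" for i
      using that assms by (intro t_cent_t) auto
    moreover have "g i \<in> centralizer (t (Suc k))" if "1 \<le> i" "i < k" for i
      using that assms t_cent_g[of i "Suc k"] by (auto intro!: centralizer_sym[of "t (Suc k)"])
    ultimately show ?thesis
      using S_centralizer[of "t (Suc k)"] assms by (auto simp: sub_gens_def)
  qed
  then show "y \<in> centralizer (t (Suc k))"
    using assms(1,2) unfolding sub_def by (intro generate_ring_centralizer) auto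
qed

lemma X_cent_X_Suc: "1 \<le> j \<Longrightarrow> j < n \<Longrightarrow> X j \<in> centralizer (X (Suc j))"
  by (intro sub_cent X_sub) auto

lemma E_cent_X: "1 \<le> i \<Longrightarrow> i < n \<Longrightarrow> 1 \<le> j \<Longrightarrow> j \<le> n \<Longrightarrow> E i \<in> centralizer (X j)"
  by (intro E_centralizer centralizer_sym[of "X j"] X_cent_t) auto

text \<open>The quadratic relation reads \<open>g i (g i - E i) = 1\<close>, and \<open>E i\<close>
  commutes with \<open>g i\<close>.\<close>

lemma
  assumes "1 \<le> i" "i < n"
  shows g_Units [simp]: "g i \<in> Units A"
    and inv_g: "inv (g i) = g i \<ominus> E i"
proof -
  have 1: "(g i \<ominus> E i) \<otimes> g i = \<one>"
    using assms by (simp add: minus_eq l_distr l_minus g_sq a_assoc r_neg)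
  have 2: "g i \<otimes> (g i \<ominus> E i) = \<one>"
    using assms by (simp add: minus_eq r_distr r_minus g_sq a_assoc r_neg E_g[symmetric])
  show "g i \<in> Units A"
    using 1 2 assms by (auto simp: Units_def intro!: bexI[of _ "g i \<ominus> E i"])
  show "inv (g i) = g i \<ominus> E i"
    using inv_unique'[OF _ _ 2 1] assms by simp
qed

lemma inv_g_sub: "1 \<le> i \<Longrightarrow> i < k \<Longrightarrow> k \<le> n \<Longrightarrow> inv (g i) \<in> sub k"
  using subringE(5,7)[OF sub_subring] g_sub[of i k] E_sub[of i k]
  by (auto simp: inv_g minus_eq)

section \<open>Products of the \<open>g\<close> along words\<close>

definition gprod :: "nat list \<Rightarrow> 'a" where
  "gprod is = lprod A (map g is)"

lemma gprod_simps [simp]: "gprod [] = \<one>" "gprod (i # is) = g i \<otimes> gprod is"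
  by (simp_all add: gprod_def)

lemma gprod_closed [simp]: "set is \<subseteq> {1..<n} \<Longrightarrow> gprod is \<in> carrier A"
  unfolding gprod_def by (intro lprod_closed) auto

lemma gprod_append:
  "set is \<subseteq> {1..<n} \<Longrightarrow> set js \<subseteq> {1..<n} \<Longrightarrow> gprod (is @ js) = gprod is \<otimes> gprod js"
  unfolding gprod_def map_append by (intro lprod_append) auto

lemma gprod_Units [simp]: "set is \<subseteq> {1..<n} \<Longrightarrow> gprod is \<in> Units A"
  by (induction "is") auto

lemma gprod_sub: "set is \<subseteq> {1..<k} \<Longrightarrow> k \<le> n \<Longrightarrow> gprod is \<in> sub k"
  unfolding gprod_def by (intro lprod_subring sub_subring) (auto simp: subset_iff intro!: g_sub)

lemma inv_gprod_sub: "set is \<subseteq> {1..<k} \<Longrightarrow> k \<le> n \<Longrightarrow> inv (gprod is) \<in> sub k"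
proof (induction "is")
  case Nil
  then show ?case using subringE(3)[OF sub_subring] by simp
next
  case (Cons i "is")
  then have "set is \<subseteq> {1..<n}" "1 \<le> i" "i < k" by auto
  with Cons show ?case
    by (auto simp: inv_mult_Units intro!: sub_mult inv_g_sub)
qed

text \<open>Both moves are relations of the algebra. Invariance of the set of letters carries the
  range condition through symmetry and transitivity.\<close>

lemma gprod_braid_eq:
  "braid_eq is js \<Longrightarrow> set is \<subseteq> {1..<n} \<Longrightarrow> gprod is = gprod js"
proof (induction rule: braid_eq.induct)
  case (far i j us vs)
  then have "gprod [i, j] = gprod [j, i]" using g_far[of i j] by simp
  moreover have "gprod (us @ [i, j] @ vs) = gprod us \<otimes> (gprod [i, j] \<otimes> gprod vs)"
    "gprod (us @ [j, i] @ vs) = gprod us \<otimes> (gprod [j, i] \<otimes> gprod vs)"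
    using far by (auto simp: gprod_append simp flip: append_Cons simp del: gprod_simps append_Cons)
  ultimately show ?case by simp
next
  case (braid us i vs)
  then have "gprod [i, i + 1, i] = gprod [i + 1, i, i + 1]" using g_braid[of i] by (simp add: m_assoc)
  moreover have "gprod (us @ [i, i + 1, i] @ vs) = gprod us \<otimes> (gprod [i, i + 1, i] \<otimes> gprod vs)"
    "gprod (us @ [i + 1, i, i + 1] @ vs) = gprod us \<otimes> (gprod [i + 1, i, i + 1] \<otimes> gprod vs)"
    using braid by (auto simp: gprod_append simp del: gprod_simps append_Cons)
  ultimately show ?case by simp
qed (auto dest: braid_eq_set)

lemma gprod_cent_X:
  "1 \<le> j \<Longrightarrow> j < i \<Longrightarrow> i \<le> l \<Longrightarrow> l \<le> n \<Longrightarrow> gprod [i..<l] \<in> centralizer (X j)"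
  unfolding gprod_def by (intro lprod_subring centralizer_subring) (auto intro!: g_cent_X_greater)

lemma gprod_cent_t:
  "1 \<le> j \<Longrightarrow> j < i \<Longrightarrow> i \<le> l \<Longrightarrow> l \<le> n \<Longrightarrow> gprod [i..<l] \<in> centralizer (t j)"
  unfolding gprod_def
  by (intro lprod_subring centralizer_subring) (auto intro!: centralizer_sym[of "t j"] t_cent_g)

lemma t_gprod:
  "i \<le> l \<Longrightarrow> 1 \<le> i \<Longrightarrow> l \<le> n \<Longrightarrow> t i \<otimes> gprod [i..<l] = gprod [i..<l] \<otimes> t l"
proof (induction l rule: dec_induct)
  case (step l)
  then have "gprod [i..<Suc l] = gprod [i..<l] \<otimes> g l"
    by (simp add: gprod_append)
  moreover have "gprod [i..<l] \<in> carrier A" using step by auto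
  ultimately show ?case
    using step t_g_swap(1)[of l] by (simp add: m_assoc[symmetric]) (simp add: m_assoc)
qed auto

end

section \<open>Vanishing of the trace\<close>

text \<open>The Markov rules with the special parameters inserted: \<open>z = 0\<close> gives
  \<open>tau_g\<close>, and the delta values of \<open>x\<close> give \<open>tau_Xt\<close>.\<close>

locale yokonuma_trace = yokonuma_hecke +
  fixes m :: nat and tau :: "'a \<Rightarrow> 'r :: ring_1"
  assumes tau_add: "\<And>y z. y \<in> carrier A \<Longrightarrow> z \<in> carrier A \<Longrightarrow> tau (y \<oplus> z) = tau y + tau z"
    and tau_comm: "\<And>y z. y \<in> carrier A \<Longrightarrow> z \<in> carrier A \<Longrightarrow> tau (y \<otimes> z) = tau (z \<otimes> y)"
    and tau_one: "tau \<one> = 1"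
    and tau_g: "\<And>k u. 1 \<le> k \<Longrightarrow> k < n \<Longrightarrow> u \<in> sub k \<Longrightarrow> tau (g k \<otimes> u) = 0"
    and tau_Xt: "\<And>k u a b. k < n \<Longrightarrow> u \<in> sub k \<Longrightarrow> a < m \<Longrightarrow> b < d \<Longrightarrow>
      tau (Xt (Suc k) [^] a \<otimes> t (Suc k) [^] b \<otimes> u) = (if a = 0 \<and> b = 0 then tau u else 0)"
    and m_pos: "0 < m"
begin

section \<open>The bimodule of elements killed by the trace\<close>

lemma tau_neg: "y \<in> carrier A \<Longrightarrow> tau (\<ominus> y) = - tau y"
  using tau_add[of y "\<ominus> y"] tau_add[of \<zero> \<zero>]
  by (intro Groups.minus_unique[symmetric]) (simp add: r_neg)

text \<open>The set \<open>N_k\<close> of the overview. Admitting all powers of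
  \<open>t (Suc k)\<close> on the right makes it stable under multiplication by
  \<open>t (Suc k)\<close>, which only shifts \<open>b\<close>.\<close>

definition null :: "nat \<Rightarrow> 'a set" where
  "null k = {z \<in> carrier A. \<forall>y \<in> sub k. \<forall>b::nat. tau (y \<otimes> z \<otimes> t (Suc k) [^] b) = 0}"

lemma nullD: "z \<in> null k \<Longrightarrow> y \<in> sub k \<Longrightarrow> tau (y \<otimes> z \<otimes> t (Suc k) [^] (b::nat)) = 0"
  by (simp add: null_def)

lemma null_closed: "z \<in> null k \<Longrightarrow> z \<in> carrier A"
  by (simp add: null_def)

lemma null_add: "k < n \<Longrightarrow> z \<in> null k \<Longrightarrow> z' \<in> null k \<Longrightarrow> z \<oplus> z' \<in> null k"
  by (auto simp: null_def r_distr l_distr tau_add sub_closed)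

lemma null_neg: "k < n \<Longrightarrow> z \<in> null k \<Longrightarrow> \<ominus> z \<in> null k"
  by (auto simp: null_def r_minus l_minus tau_neg sub_closed)

lemma null_left: "k < n \<Longrightarrow> u \<in> sub k \<Longrightarrow> z \<in> null k \<Longrightarrow> u \<otimes> z \<in> null k"
  using sub_mult[of k]
  by (auto simp: null_def sub_closed m_assoc[symmetric])

lemma t_pow_cent_sub: "k < n \<Longrightarrow> u \<in> sub k \<Longrightarrow> t (Suc k) [^] (b::nat) \<in> centralizer u"
  using sub_cent(2)[of k u] sub_closed[of u k]
  by (intro centralizer_pow centralizer_sym[of u]) auto

text \<open>\<open>u\<close> commutes with the power of \<open>t (Suc k)\<close>, and the trace
  property then carries it to the front, where it is absorbed into \<open>y\<close>.\<close>

lemma null_right: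
  assumes "k < n" "u \<in> sub k" "z \<in> null k"
  shows "z \<otimes> u \<in> null k"
proof -
  have [simp]: "u \<in> carrier A" "z \<in> carrier A" using assms sub_closed null_closed by auto
  have "tau (y \<otimes> (z \<otimes> u) \<otimes> t (Suc k) [^] b) = 0" if y: "y \<in> sub k" for y and b :: nat
  proof -
    have [simp]: "y \<in> carrier A" using assms sub_closed y by auto
    have "tau (y \<otimes> (z \<otimes> u) \<otimes> t (Suc k) [^] b) = tau ((y \<otimes> z \<otimes> t (Suc k) [^] b) \<otimes> u)"
      using assms centralizerD[OF t_pow_cent_sub[of k u b]] by (simp add: m_assoc)
    also have "\<dots> = tau (u \<otimes> y \<otimes> z \<otimes> t (Suc k) [^] b)"
      using assms by (subst tau_comm) (auto simp: m_assoc)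
    also have "\<dots> = 0"
      using assms y by (intro nullD sub_mult) auto
    finally show ?thesis .
  qed
  then show ?thesis by (auto simp: null_def)
qed

text \<open>\<open>t (Suc k)\<close> commutes with \<open>y\<close>, and the trace property moves it
  to the far end, where it raises \<open>b\<close> by one.\<close>

lemma null_t_left:
  assumes "k < n" "z \<in> null k"
  shows "t (Suc k) \<otimes> z \<in> null k"
proof -
  let ?t = "t (Suc k)"
  have [simp]: "z \<in> carrier A" "?t \<in> carrier A" using assms null_closed by auto
  have "tau (y \<otimes> (?t \<otimes> z) \<otimes> ?t [^] b) = 0" if y: "y \<in> sub k" for y and b :: nat
  proof -
    have [simp]: "y \<in> carrier A" using assms sub_closed y by auto
    have "tau (y \<otimes> (?t \<otimes> z) \<otimes> ?t [^] b) = tau (?t \<otimes> (y \<otimes> z \<otimes> ?t [^] b))"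
      using assms centralizerD'[OF sub_cent(2), of k y "z \<otimes> ?t [^] b"] y by (simp add: m_assoc)
    also have "\<dots> = tau (y \<otimes> z \<otimes> ?t [^] Suc b)"
      by (subst tau_comm) (auto simp: m_assoc)
    also have "\<dots> = 0"
      using assms y by (intro nullD)
    finally show ?thesis .
  qed
  then show ?thesis by (auto simp: null_def)
qed

text \<open>A subring, so that stability of \<open>null k\<close> under an element such as a
  conjugate of \<open>E j\<close> can be checked on generators.\<close>

definition multiplier :: "nat \<Rightarrow> 'a set" where
  "multiplier k = {y \<in> carrier A. \<forall>z \<in> null k. y \<otimes> z \<in> null k}"

lemma multiplier_subring: "k < n \<Longrightarrow> subring (multiplier k) A"
  by (rule subringI)
    (auto simp: multiplier_def m_assoc l_distr l_minus null_closed null_add null_neg)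

lemma sub_multiplier: "k < n \<Longrightarrow> y \<in> sub k \<Longrightarrow> y \<in> multiplier k"
  by (auto simp: multiplier_def sub_closed null_left)

lemma t_multiplier: "k < n \<Longrightarrow> t (Suc k) \<in> multiplier k"
  by (auto simp: multiplier_def null_t_left)

text \<open>Moving powers of \<open>t (Suc k)\<close> to the left of \<open>g k\<close> turns them
  into powers of \<open>t k\<close>, which lie on \<open>k\<close> strands; the rule
  \<open>tau_g\<close> then applies after a cyclic rotation.\<close>

lemma g_null:
  assumes "1 \<le> k" "k < n"
  shows "g k \<in> null k"
proof -
  have sw: "g k \<otimes> t (Suc k) [^] b = t k [^] b \<otimes> g k" for b :: nat
  proof (induction b)
    case (Suc b)
    have "g k \<otimes> t (Suc k) [^] Suc b = t k [^] b \<otimes> (g k \<otimes> t (Suc k))"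
      using assms Suc by (simp add: m_assoc[symmetric])
    also have "\<dots> = t k [^] Suc b \<otimes> g k"
      using assms t_g_swap(1)[of k] by (simp add: m_assoc)
    finally show ?case .
  qed (use assms in auto)
  have "tau (y \<otimes> g k \<otimes> t (Suc k) [^] b) = 0" if y: "y \<in> sub k" for y and b :: nat
  proof -
    have [simp]: "y \<in> carrier A" using assms sub_closed y by auto
    have "tau (y \<otimes> g k \<otimes> t (Suc k) [^] b) = tau ((y \<otimes> t k [^] b) \<otimes> g k)"
      using assms by (simp add: m_assoc sw)
    also have "\<dots> = tau (g k \<otimes> (y \<otimes> t k [^] b))"
      using assms by (intro tau_comm) auto
    also have "\<dots> = 0"
      using assms y by (intro tau_g sub_mult nat_pow_subring sub_subring t_sub) auto
    finally show ?thesis .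
  qed
  then show ?thesis using assms by (auto simp: null_def)
qed

section \<open>From the conjugates of \<open>X_1\<close> to the Jucys--Murphy elements\<close>

lemma Xt_closed [simp]: "1 \<le> j \<Longrightarrow> j \<le> n \<Longrightarrow> Xt j \<in> carrier A"
proof (induction j rule: dec_induct)
  case (step j)
  then show ?case by (simp add: Xt_Suc)
qed (simp add: Xt_1)

lemma t_pow_mod:
  assumes "1 \<le> j" "j \<le> n"
  shows "t j [^] b = t j [^] (b mod d)"
proof -
  have "t j [^] b = t j [^] (d * (b div d) + b mod d)" by simp
  also have "\<dots> = (t j [^] d) [^] (b div d) \<otimes> t j [^] (b mod d)"
    using assms by (simp only: nat_pow_mult[symmetric] nat_pow_pow t_closed)
  finally show ?thesis using assms by (simp add: t_pow)
qed

text \<open>Rotate \<open>y\<close> to the right and apply \<open>tau_Xt\<close>; its bound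
  \<open>b < d\<close> is reached by reducing the exponent modulo \<open>d\<close>.\<close>

lemma Xt_null:
  assumes "k < n" "0 < a" "a < m"
  shows "Xt (Suc k) [^] a \<in> null k"
proof -
  have "tau (y \<otimes> Xt (Suc k) [^] a \<otimes> t (Suc k) [^] b) = 0" if y: "y \<in> sub k" for y and b :: nat
  proof -
    have [simp]: "y \<in> carrier A" using assms sub_closed y by auto
    have "tau (y \<otimes> Xt (Suc k) [^] a \<otimes> t (Suc k) [^] b) =
        tau (y \<otimes> (Xt (Suc k) [^] a \<otimes> t (Suc k) [^] (b mod d)))"
      using assms t_pow_mod[of "Suc k" b] by (simp add: m_assoc)
    also have "\<dots> = tau (Xt (Suc k) [^] a \<otimes> t (Suc k) [^] (b mod d) \<otimes> y)"
      using assms by (intro tau_comm) auto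
    also have "\<dots> = 0"
      using assms y d_pos by (subst tau_Xt) auto
    finally show ?thesis .
  qed
  then show ?thesis using assms by (auto simp: null_def)
qed

lemma Xt_conj: "k < n \<Longrightarrow> Xt (Suc k) = conj (gprod [1..<Suc k]) (X (Suc 0))"
proof (induction k)
  case 0
  then show ?case by (simp add: Xt_1 conj_def)
next
  case (Suc k)
  have "gprod [1..<Suc (Suc k)] = gprod [1..<Suc k] \<otimes> g (Suc k)"
    using Suc.prems by (subst upt_Suc_append) (auto simp: gprod_append simp del: upt_Suc)
  then have "conj (gprod [1..<Suc (Suc k)]) (X (Suc 0)) = conj (g (Suc k)) (Xt (Suc k))"
    using Suc by (subst Suc.IH) (auto simp: conj_conj simp del: upt_Suc)
  then show ?case
    using Suc.prems by (simp add: Xt_Suc conj_def)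
qed

text \<open>The braid relations turn this conjugate of \<open>g\<^sub>j\<close> into a conjugate of \<open>g\<^sub>k\<close> by an element on
  \<open>k\<close> strands.\<close>

lemma conj_g_null:
  assumes "1 \<le> j" "j \<le> k" "k < n"
  shows "conj (gprod [Suc j..<Suc k]) (g j) \<in> null k"
proof -
  let ?p = "gprod [Suc j..<Suc k]" and ?q = "gprod [j..<k]"
  have U [simp]: "?p \<in> Units A" "?q \<in> Units A" using assms by (auto simp del: upt_Suc)
  have C [simp]: "?p \<in> carrier A" "?q \<in> carrier A" "g j \<in> carrier A" "g k \<in> carrier A"
    using U assms by (auto simp del: upt_Suc U)
  have 1: "gprod [j..<Suc k] = g j \<otimes> ?p"
    using assms by (simp add: upt_conv_Cons del: upt_Suc)
  have 2: "gprod [j..<Suc k] = ?q \<otimes> g k"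
    using assms by (simp add: gprod_append)
  \<comment> \<open>With \<open>h = g j ... g k = g j p = q g k\<close> this says
    \<open>h q = p h\<close>. Cancelling \<open>p\<close> leaves
    \<open>q g k = conj p (g j) q\<close>.\<close>
  have "gprod ([j..<Suc k] @ [j..<k]) = gprod ([Suc j..<Suc k] @ [j..<Suc k])"
    using assms by (intro gprod_braid_eq braid_eq_ascending) auto
  then have 3: "gprod [j..<Suc k] \<otimes> ?q = ?p \<otimes> gprod [j..<Suc k]"
    using assms by (simp add: gprod_append del: upt_Suc)
  have "?p \<otimes> (?q \<otimes> g k) = (?q \<otimes> g k) \<otimes> ?q" using 3 2 by simp
  then have "inv ?p \<otimes> (?p \<otimes> (?q \<otimes> g k)) = inv ?p \<otimes> ((g j \<otimes> ?p) \<otimes> ?q)" using 1 2 by simp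
  then have "?q \<otimes> g k = conj ?p (g j) \<otimes> ?q"
    by (simp add: conj_cancel conj_def m_assoc del: upt_Suc)
  then have "?q \<otimes> g k \<otimes> inv ?q = conj ?p (g j) \<otimes> (?q \<otimes> inv ?q)"
    using U(1) C(3) by (simp only: m_assoc conj_closed C(2) U Units_inv_closed)
  then have "conj ?p (g j) = ?q \<otimes> g k \<otimes> inv ?q"
    by (simp del: upt_Suc)
  also have "\<dots> \<in> null k"
    using assms by (intro null_right null_left g_null gprod_sub inv_gprod_sub) auto
  finally show ?thesis .
qed

text \<open>Conjugation by \<open>g (j+1) ... g k\<close> fixes the scalars and \<open>t j\<close>
  and sends \<open>t (j+1)\<close> to \<open>t (k+1)\<close>. All of these are multipliers, and the
  preimage \<open>?K\<close> of the multipliers is a subring.\<close>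

lemma conj_E_multiplier:
  assumes "1 \<le> j" "j \<le> k" "k < n"
  shows "conj (gprod [Suc j..<Suc k]) (E j) \<in> multiplier k"
proof -
  let ?p = "gprod [Suc j..<Suc k]"
  have U [simp]: "?p \<in> Units A" using assms by (auto simp del: upt_Suc)
  have C [simp]: "?p \<in> carrier A" using U by blast
  let ?K = "{z \<in> carrier A. conj ?p z \<in> multiplier k}"
  note M = subringE[OF multiplier_subring[OF assms(3)]]
  have "subring ?K A"
    by (rule subringI) (auto simp: conj_mult conj_add conj_neg M simp del: upt_Suc)
  moreover have "S \<subseteq> ?K"
  proof
    fix s assume s: "s \<in> S"
    then have "s \<in> carrier A" using S_closed by auto
    moreover from this have "conj ?p s = s"
      using s S_centralizer[of ?p] by (intro conj_commuting centralizer_sym[of s]) (auto simp del: upt_Suc)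
    ultimately show "s \<in> ?K" using s assms sub_multiplier[OF _ S_sub] by (simp del: upt_Suc)
  qed
  moreover have "t j \<in> ?K"
  proof -
    have "conj ?p (t j) = t j"
      using assms by (intro conj_commuting gprod_cent_t) (auto simp del: upt_Suc)
    then show ?thesis using assms sub_multiplier[OF _ t_sub] by (simp del: upt_Suc)
  qed
  moreover have "t (Suc j) \<in> ?K"
  proof -
    have "t (Suc j) \<otimes> ?p = ?p \<otimes> t (Suc k)"
      using assms by (intro t_gprod) auto
    then have "conj ?p (t (Suc j)) = t (Suc k)"
      using assms by (simp add: conj_def m_assoc conj_cancel del: upt_Suc)
    then show ?thesis using assms t_multiplier by (simp del: upt_Suc)
  qed
  ultimately have "generate_ring A (S \<union> {t j, t (Suc j)}) \<subseteq> ?K"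
    using assms S_closed by (intro generate_ring_min_subring1) auto
  then show ?thesis using E_gen[of j] assms by (auto simp del: upt_Suc)
qed

text \<open>Expanding \<open>X (Suc j)\<close> puts \<open>g j\<close> next to another
  \<open>g j\<close>, where the quadratic relation applies. This exchange rule drives both
  inductions below.\<close>

lemma g_X_Suc:
  assumes "1 \<le> j" "j < n"
  shows "g j \<otimes> X (Suc j) = X j \<otimes> g j \<oplus> E j \<otimes> X (Suc j)"
proof -
  have "g j \<otimes> X (Suc j) = (g j \<otimes> g j) \<otimes> (X j \<otimes> g j)"
    using assms by (simp add: X_Suc m_assoc)
  also have "\<dots> = X j \<otimes> g j \<oplus> E j \<otimes> X (Suc j)"
    using assms by (simp add: g_sq l_distr X_Suc m_assoc)
  finally show ?thesis .
qed

text \<open>Going from \<open>j\<close> to \<open>j + 1\<close>, \<open>g\<^sub>j\<^sup>-\<^sup>1 X\<^sub>j\<^sup>a g\<^sub>j\<close> is deformed into \<open>X\<^sub>j\<^sub>+\<^sub>1\<^sup>a\<close> through the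
  elements \<open>g\<^sub>j\<^sup>-\<^sup>1 X\<^sub>j\<^sup>a\<^sup>-\<^sup>r g\<^sub>j X\<^sub>j\<^sub>+\<^sub>1\<^sup>r\<close>.\<close>

lemma conj_X_null:
  assumes "1 \<le> j" "j \<le> Suc k" "k < n" "0 < a" "a < m"
  shows "conj (gprod [j..<Suc k]) (X j [^] a) \<in> null k"
  using assms
proof (induction j arbitrary: a rule: dec_induct)
  case base
  have "conj (gprod [1..<Suc k]) (X 1 [^] a) = Xt (Suc k) [^] a"
    using base by (subst conj_pow) (auto simp: Xt_conj simp del: upt_Suc)
  then show ?case using base Xt_null by simp
next
  case (step j)
  let ?p = "gprod [Suc j..<Suc k]" and ?X = "X j" and ?Y = "X (Suc j)" and ?g = "g j" and ?E = "E j"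
  have j: "1 \<le> j" "j \<le> k" "j < n" using step by auto
  have U [simp]: "?p \<in> Units A" using step by (auto simp del: upt_Suc)
  have C [simp]: "?X \<in> carrier A" "?Y \<in> carrier A" "?g \<in> carrier A" "?E \<in> carrier A"
    "?g \<in> Units A" using j step by auto
  have XY: "?X [^] (i::nat) \<in> centralizer (?Y [^] (l::nat))" for i l
    using j X_cent_X_Suc[of j]
    by (intro centralizer_pow centralizer_sym[OF centralizer_pow] centralizer_sym[OF X_cent_X_Suc]) auto
  \<comment> \<open>\<open>V\<close> is the preimage of \<open>null k\<close> under conjugation by
    \<open>?p\<close>. Since \<open>?p\<close> commutes with \<open>X j\<close>, which lies on
    \<open>k\<close> strands, \<open>V\<close> is stable under \<open>X j\<close> on both
    sides.\<close>
  define V where "V = {z \<in> carrier A. conj ?p z \<in> null k}"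
  have V_add: "y \<oplus> z \<in> V" if "y \<in> V" "z \<in> V" for y z
    using that step.prems null_add by (auto simp: V_def conj_add simp del: upt_Suc)
  have cX: "conj ?p (?X [^] (i::nat)) = ?X [^] i" for i
    using j step.prems
    by (subst conj_pow) (auto simp: conj_commuting gprod_cent_X simp del: upt_Suc)
  have X_sub_k: "?X [^] (i::nat) \<in> sub k" for i
    using j step.prems by (intro nat_pow_subring sub_subring X_sub) auto
  have V_X: "?X [^] (i::nat) \<otimes> z \<in> V" "z \<otimes> ?X [^] i \<in> V" if "z \<in> V" for i z
    using that step.prems X_sub_k
    by (auto simp: V_def conj_mult cX null_left null_right simp del: upt_Suc)
  have V_X1: "?X \<otimes> z \<in> V" if "z \<in> V" for z
    using V_X(1)[OF that, of 1] by simp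
  have V_E: "?E \<otimes> z \<in> V" if "z \<in> V" for z
    using that conj_E_multiplier[OF j(1,2) \<open>k < n\<close>]
    by (auto simp: V_def multiplier_def conj_mult simp del: upt_Suc)
  have V_g: "?g \<in> V"
    using conj_g_null[OF j(1,2) \<open>k < n\<close>] by (simp add: V_def)
  show ?case
    using step.prems
  proof (induction a rule: less_induct)
    case (less a)
    \<comment> \<open>Strong induction on \<open>a\<close> supplies the smaller positive powers of
      \<open>X (Suc j)\<close>.\<close>
    have Y_V: "?Y [^] r \<in> V" if "0 < r" "r < a" for r
      using less.IH[OF that(2)] that less.prems by (simp add: V_def)
    \<comment> \<open>The exchange rule raises the exponent; its extra term has exponent
      \<open>Suc r < a\<close> and is covered by \<open>Y_V\<close>.\<close>
    have gY_V: "?g \<otimes> ?Y [^] r \<in> V" if "r < a" for r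
      using that
    proof (induction r)
      case (Suc r)
      have "?g \<otimes> ?Y [^] Suc r = (?g \<otimes> ?Y) \<otimes> ?Y [^] r"
        by (simp add: nat_pow_Suc2 m_assoc del: nat_pow_Suc Group.nat_pow_Suc)
      also have "\<dots> = ?X \<otimes> (?g \<otimes> ?Y [^] r) \<oplus> ?E \<otimes> ?Y [^] Suc r"
        using j by (simp add: g_X_Suc l_distr m_assoc nat_pow_Suc2 del: nat_pow_Suc Group.nat_pow_Suc)
      also have "\<dots> \<in> V"
        using Suc by (intro V_add V_X1 V_E Y_V) auto
      finally show ?case .
    qed (use V_g in simp)
    \<comment> \<open>At \<open>r = 0\<close> this is the outer induction hypothesis, at
      \<open>r = a\<close> it is the wanted power of \<open>X (Suc j)\<close>.\<close>
    have "inv ?g \<otimes> ?X [^] (a - r) \<otimes> ?g \<otimes> ?Y [^] r \<in> V" if "r \<le> a" for r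
      using that
    proof (induction r)
      case 0
      have "conj (gprod [j..<Suc k]) (?X [^] a) = conj ?p (conj ?g (?X [^] a))"
        using step.prems j by (subst conj_conj) (auto simp: upt_conv_Cons simp del: upt_Suc)
      then show ?case
        using step.IH[of a] less.prems j by (simp add: V_def conj_def[of ?g] del: upt_Suc)
    next
      case (Suc r)
      define i where "i = a - Suc r"
      have i: "a - r = Suc i" using Suc.prems by (simp add: i_def)
      have "inv ?g \<otimes> ?X [^] i \<otimes> ?g \<otimes> ?Y [^] Suc r = inv ?g \<otimes> ?X [^] i \<otimes> (?g \<otimes> ?Y) \<otimes> ?Y [^] r"
        by (simp add: nat_pow_Suc2 m_assoc del: nat_pow_Suc Group.nat_pow_Suc)
      also have "\<dots> = inv ?g \<otimes> ?X [^] Suc i \<otimes> ?g \<otimes> ?Y [^] r \<oplus>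
          inv ?g \<otimes> (?X [^] i \<otimes> (?E \<otimes> (?Y \<otimes> ?Y [^] r)))"
        using j by (simp add: g_X_Suc l_distr r_distr m_assoc)
      \<comment> \<open>\<open>E j\<close> commutes with \<open>X j\<close> and with the inverse of
        \<open>g j\<close>, so it moves to the front, and the inverse of \<open>g j\<close> times
        \<open>X (Suc j)\<close> is \<open>X j g j\<close>. The result is built from
        \<open>g j X (Suc j)^r\<close> with \<open>r < a\<close>, hence lies in
        \<open>V\<close>.\<close>
      also have "inv ?g \<otimes> (?X [^] i \<otimes> (?E \<otimes> (?Y \<otimes> ?Y [^] r))) = ?E \<otimes> (?X \<otimes> (?g \<otimes> ?Y [^] r \<otimes> ?X [^] i))"
      proof -
        have EX: "?X [^] i \<in> centralizer ?E"
          using j E_cent_X[of j j] by (intro centralizer_pow centralizer_sym[of ?E]) auto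
        have "?g \<in> centralizer ?E" using j E_g[of j] by (intro centralizerI) auto
        then have Eg: "inv ?g \<in> centralizer ?E" by (rule centralizer_inverse) auto
        have "?X [^] i \<otimes> (?E \<otimes> (?Y \<otimes> ?Y [^] r)) = ?E \<otimes> (?Y [^] Suc r \<otimes> ?X [^] i)"
          using centralizerD[OF XY[of i "Suc r"]] centralizerD'[OF EX, of "?Y \<otimes> ?Y [^] r"]
          by (simp add: nat_pow_Suc2 del: nat_pow_Suc Group.nat_pow_Suc)
        also have "inv ?g \<otimes> \<dots> = ?E \<otimes> (inv ?g \<otimes> ?Y \<otimes> (?Y [^] r \<otimes> ?X [^] i))"
          using centralizerD'[OF Eg, of "?Y [^] Suc r \<otimes> ?X [^] i"]
          by (simp add: nat_pow_Suc2 m_assoc del: nat_pow_Suc Group.nat_pow_Suc)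
        also have "inv ?g \<otimes> ?Y = ?X \<otimes> ?g"
          using j by (simp add: X_Suc m_assoc conj_cancel)
        finally show ?thesis by (simp add: m_assoc)
      qed
      also have "inv ?g \<otimes> ?X [^] Suc i \<otimes> ?g \<otimes> ?Y [^] r \<oplus> ?E \<otimes> (?X \<otimes> (?g \<otimes> ?Y [^] r \<otimes> ?X [^] i)) \<in> V"
        using Suc i by (intro V_add V_E V_X1 V_X gY_V) auto
      finally show ?case by (simp add: i_def)
    qed
    from this[of a] have "?Y [^] a \<in> V" by simp
    then show ?case by (simp add: V_def)
  qed
qed

text \<open>The end of the deformation, \<open>j = k + 1\<close>, where the conjugating product is
  empty.\<close>

lemma X_null: "k < n \<Longrightarrow> 0 < a \<Longrightarrow> a < m \<Longrightarrow> X (Suc k) [^] a \<in> null k"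
  using conj_X_null[of "Suc k" k a] by (simp add: conj_def)

text \<open>The exchange rule again, starting from \<open>g_null\<close>: \<open>X k\<close> lies on
  \<open>k\<close> strands, and \<open>E k\<close> is a multiplier by the case \<open>j = k\<close>
  of \<open>conj_E_multiplier\<close>.\<close>

lemma g_X_null:
  assumes "1 \<le> k" "k < n" "a < m"
  shows "g k \<otimes> X (Suc k) [^] a \<in> null k"
  using assms(3)
proof (induction a)
  case 0
  then show ?case using assms g_null by simp
next
  case (Suc a)
  let ?Y = "X (Suc k)"
  have [simp]: "?Y \<in> carrier A" "g k \<in> carrier A" "E k \<in> carrier A" "X k \<in> carrier A"
    using assms by auto
  have "g k \<otimes> ?Y [^] Suc a = (g k \<otimes> ?Y) \<otimes> ?Y [^] a"
    by (simp add: nat_pow_Suc2 m_assoc del: nat_pow_Suc Group.nat_pow_Suc)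
  also have "\<dots> = X k \<otimes> (g k \<otimes> ?Y [^] a) \<oplus> E k \<otimes> ?Y [^] Suc a"
    using assms by (simp add: g_X_Suc l_distr m_assoc nat_pow_Suc2 del: nat_pow_Suc Group.nat_pow_Suc)
  also have "\<dots> \<in> null k"
  proof (rule null_add)
    show "X k \<otimes> (g k \<otimes> ?Y [^] a) \<in> null k"
      using assms Suc by (intro null_left[OF _ X_sub]) auto
    have "E k \<in> multiplier k"
      using conj_E_multiplier[of k k] assms by (simp add: conj_def)
    then show "E k \<otimes> ?Y [^] Suc a \<in> null k"
      using X_null[of k "Suc a"] assms Suc by (simp add: multiplier_def)
  qed (use assms in simp)
  finally show ?case .
qed

section \<open>The trace of a basis element\<close>

definition Xprod :: "nat \<Rightarrow> (nat \<Rightarrow> nat) \<Rightarrow> 'a" where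
  "Xprod k a = lprod A (map (\<lambda>i. X i [^] a i) [1..<Suc k])"

definition tprod :: "nat \<Rightarrow> (nat \<Rightarrow> nat) \<Rightarrow> 'a" where
  "tprod k b = lprod A (map (\<lambda>i. t i [^] b i) [1..<Suc k])"

lemma Xprod_sub: "k \<le> n \<Longrightarrow> Xprod k a \<in> sub k"
  unfolding Xprod_def
  by (intro lprod_subring sub_subring) (auto intro!: nat_pow_subring sub_subring X_sub simp del: upt_Suc)

lemma tprod_sub: "k \<le> n \<Longrightarrow> tprod k b \<in> sub k"
  unfolding tprod_def
  by (intro lprod_subring sub_subring) (auto intro!: nat_pow_subring sub_subring t_sub simp del: upt_Suc)

lemma Xprod_Suc: "k < n \<Longrightarrow> Xprod (Suc k) a = Xprod k a \<otimes> X (Suc k) [^] a (Suc k)"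
  unfolding Xprod_def
  by (subst upt_Suc_append, simp, subst map_append, subst lprod_append) (auto simp del: upt_Suc)

lemma tprod_Suc: "k < n \<Longrightarrow> tprod (Suc k) b = tprod k b \<otimes> t (Suc k) [^] b (Suc k)"
  unfolding tprod_def
  by (subst upt_Suc_append, simp, subst map_append, subst lprod_append) (auto simp del: upt_Suc)

text \<open>Each step splits off the last strand. If the descending factor is empty, only
  \<open>X (Suc k)\<close> and \<open>t (Suc k)\<close> involve that strand; otherwise the factor
  starts with \<open>g k\<close> and the trace vanishes by \<open>g_X_null\<close>.\<close>

lemma tau_normal_word:
  assumes "normal_word k us" "k \<le> n" "\<forall>i\<in>{1..k}. a i < m" "\<forall>i\<in>{1..k}. b i < d"
  shows "tau (Xprod k a \<otimes> tprod k b \<otimes> gprod us) =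
    (if us = [] \<and> (\<forall>i\<in>{1..k}. a i = 0 \<and> b i = 0) then 1 else 0)"
  using assms
proof (induction rule: normal_word.induct)
  case zero
  then show ?case by (simp add: Xprod_def tprod_def tau_one)
next
  case (Suc k us i)
  let ?D = "rev [i..<Suc k]" and ?a = "a (Suc k)" and ?b = "b (Suc k)"
  let ?Y = "X (Suc k)" and ?t = "t (Suc k)"
  have k: "k < n" using Suc.prems by simp
  have us: "set us \<subseteq> {1..<k}" using Suc.hyps by (intro normal_word_set)
  define y where "y = Xprod k a \<otimes> tprod k b \<otimes> gprod us"
  have y: "y \<in> sub k"
    unfolding y_def using k us by (intro sub_mult Xprod_sub tprod_sub gprod_sub) auto
  have [simp]: "?Y \<in> carrier A" "?t \<in> carrier A" using k by auto
  have [simp]: "Xprod k a \<in> carrier A" "tprod k b \<in> carrier A" "y \<in> carrier A"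
    using k y Xprod_sub[of k] tprod_sub[of k] by (auto intro: sub_closed[of _ k])
  have "set us \<subseteq> {1..<n}" "set ?D \<subseteq> {1..<n}" using us k Suc.hyps by auto
  then have [simp]: "gprod us \<in> carrier A" "gprod ?D \<in> carrier A" by (auto simp del: upt_Suc)
  have Y: "u \<otimes> (?Y [^] (l::nat) \<otimes> z) = ?Y [^] l \<otimes> (u \<otimes> z)" if "u \<in> sub k" "z \<in> carrier A" for u l z
    using that k sub_cent(1)[of k u] sub_closed[of u k]
    by (intro centralizerD' centralizer_sym[OF centralizer_pow[OF centralizer_sym]]) auto
  have T: "u \<otimes> (?t [^] (l::nat) \<otimes> z) = ?t [^] l \<otimes> (u \<otimes> z)" if "u \<in> sub k" "z \<in> carrier A" for u l z
    using that k sub_closed[of u k]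
    by (intro centralizerD' centralizer_sym[OF t_pow_cent_sub]) auto
  have gD: "gprod (us @ ?D) = gprod us \<otimes> gprod ?D"
    using us k Suc.hyps by (intro gprod_append) auto
  \<comment> \<open>The powers of \<open>X (Suc k)\<close> and \<open>t (Suc k)\<close> commute with
    everything on \<open>k\<close> strands, so that part collects into \<open>y\<close>.\<close>
  have eq: "Xprod (Suc k) a \<otimes> tprod (Suc k) b \<otimes> gprod (us @ ?D) =
      y \<otimes> ?Y [^] ?a \<otimes> ?t [^] ?b \<otimes> gprod ?D"
    using k us
    by (simp add: Xprod_Suc tprod_Suc gD y_def m_assoc Y[OF tprod_sub, symmetric]
        Y[OF gprod_sub] T[OF gprod_sub] del: upt_Suc)
  show ?case
  proof (cases "i = Suc k")
    case True
    have *: "tau (y \<otimes> ?Y [^] ?a \<otimes> ?t [^] ?b) = (if ?a = 0 \<and> ?b = 0 then tau y else 0)"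
    proof (cases "?a = 0")
      case False
      then show ?thesis
        using X_null[of k ?a] k Suc.prems y by (auto intro!: nullD)
    next
      case True
      \<comment> \<open>The trivial power of \<open>Xt\<close> gives the shape of
        \<open>tau_Xt\<close>, whose bound on the exponent is here \<open>0 < m\<close>.\<close>
      have "tau (y \<otimes> ?t [^] ?b) = tau (Xt (Suc k) [^] (0::nat) \<otimes> ?t [^] ?b \<otimes> y)"
        using k by (simp add: tau_comm)
      also have "\<dots> = (if ?b = 0 then tau y else 0)"
        using k y Suc.prems m_pos by (subst tau_Xt) auto
      finally show ?thesis using True by simp
    qed
    have "tau y = (if us = [] \<and> (\<forall>i\<in>{1..k}. a i = 0 \<and> b i = 0) then 1 else 0)"
      unfolding y_def using Suc by (intro Suc.IH) auto
    with * True show ?thesis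
      unfolding eq by (auto simp: atLeastAtMostSuc_conv)
  next
    case False
    then have i: "i \<le> k" using Suc.hyps by simp
    define u where "u = gprod (rev [i..<k])"
    have u: "u \<in> sub k" unfolding u_def using Suc.hyps k by (intro gprod_sub) auto
    have [simp]: "u \<in> carrier A" "g k \<in> carrier A" using u k sub_closed i Suc.hyps by auto
    have D: "gprod ?D = g k \<otimes> u" using i by (simp add: u_def)
    \<comment> \<open>\<open>X (Suc k)\<close> goes cyclically to the end and back past
      \<open>u\<close> to stand beside \<open>g k\<close>; the power of \<open>t (Suc k)\<close>
      goes to the end, as \<open>nullD\<close> requires.\<close>
    have "tau (y \<otimes> ?Y [^] ?a \<otimes> ?t [^] ?b \<otimes> gprod ?D) =
        tau (?Y [^] ?a \<otimes> (y \<otimes> ?t [^] ?b \<otimes> g k \<otimes> u))"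
      unfolding D using y by (simp add: m_assoc Y)
    also have "\<dots> = tau (y \<otimes> (?t [^] ?b \<otimes> (g k \<otimes> (u \<otimes> ?Y [^] ?a))))"
      by (subst tau_comm) (auto simp: m_assoc)
    also have "\<dots> = tau (?t [^] ?b \<otimes> (y \<otimes> (g k \<otimes> ?Y [^] ?a \<otimes> u)))"
      using y u Y[OF u, of \<one> ?a] by (simp add: T m_assoc)
    also have "\<dots> = tau (y \<otimes> (g k \<otimes> ?Y [^] ?a \<otimes> u) \<otimes> ?t [^] ?b)"
      by (intro tau_comm) auto
    also have "\<dots> = 0"
    proof (rule nullD[OF null_right])
      show "g k \<otimes> ?Y [^] ?a \<in> null k" using g_X_null k i Suc by auto
    qed (use k u y in auto)
    finally have "tau (y \<otimes> ?Y [^] ?a \<otimes> ?t [^] ?b \<otimes> gprod ?D) = 0" .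
    moreover have "us @ ?D \<noteq> []" using i by simp
    ultimately show ?thesis unfolding eq by (simp only: simp_thms if_False)
  qed
qed

end

section \<open>The quotient presentation\<close>

lemma laurent_ring_add: "p \<in> laurent_ring m \<Longrightarrow> r \<in> laurent_ring m \<Longrightarrow> p + r \<in> laurent_ring m"
  using Poly_Mapping.keys_add[of p r] by (fastforce simp: laurent_ring_def)

lemma laurent_ring_uminus: "p \<in> laurent_ring m \<Longrightarrow> - p \<in> laurent_ring m"
  by (simp add: laurent_ring_def)

lemma laurent_ring_mult:
  assumes "p \<in> laurent_ring m" "r \<in> laurent_ring m"
  shows "p * r \<in> laurent_ring m"
  unfolding laurent_ring_def
proof safe
  fix e x assume "e \<in> Poly_Mapping.keys (p * r)" "x \<in> Poly_Mapping.keys e"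
  then obtain a b where "e = a + b" "a \<in> Poly_Mapping.keys p" "b \<in> Poly_Mapping.keys r"
    using keys_mult[of p r] by blast
  then show "x \<in> {0..m}"
    using assms \<open>x \<in> _\<close> Poly_Mapping.keys_add[of a b] unfolding laurent_ring_def by blast
qed

lemma laurent_ring_consts:
  "0 \<in> laurent_ring m" "1 \<in> laurent_ring m" "q_var \<in> laurent_ring m" "q_inv \<in> laurent_ring m"
  "laurent_const c \<in> laurent_ring m" "i \<le> m \<Longrightarrow> v_var i \<in> laurent_ring m"
  by (auto simp: laurent_ring_def q_var_def q_inv_def laurent_const_def v_var_def)

lemma laurent_ring_diff: "p \<in> laurent_ring m \<Longrightarrow> r \<in> laurent_ring m \<Longrightarrow> p - r \<in> laurent_ring m"
  using laurent_ring_add[of p m "- r"] laurent_ring_uminus[of r m] by simp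

lemma laurent_ring_sum:
  "(\<And>x. x \<in> T \<Longrightarrow> f x \<in> laurent_ring m) \<Longrightarrow> sum f T \<in> laurent_ring m"
  by (induction T rule: infinite_finite_induct) (auto simp: laurent_ring_consts laurent_ring_add)

lemma laurent_ring_Sum_any: "(\<And>x. f x \<in> laurent_ring m) \<Longrightarrow> Sum_any f \<in> laurent_ring m"
  unfolding Sum_any.expand_set by (rule laurent_ring_sum)

text \<open>A scalar is supported on the empty word, which is neutral for concatenation, and the
  coefficients commute; \<open>f\<close> is built one monomial at a time.\<close>

lemma scal_commute: "scal c * f = f * scal c"
proof (induction f rule: update_induct)
  case (update f a b)
  then have "Poly_Mapping.update a b f = f + Poly_Mapping.single a b"
    by (intro poly_mapping_eqI) (auto simp: lookup_update lookup_add lookup_single in_keys_iff when_def)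
  then show ?case
    using update.IH by (simp add: scal_def mult_single mult.commute distrib_left distrib_right)
qed simp

lemma genideal_relator_eq:
  fixes R (structure)
  assumes "ring R" "Z \<subseteq> carrier R" "x \<in> carrier R" "y \<in> carrier R" "x \<ominus> y \<in> Z"
  shows "genideal R Z +> x = genideal R Z +> y"
proof -
  interpret ring R by fact
  have I: "ideal (genideal R Z) R" using assms(2) by (rule genideal_ideal)
  have "x \<ominus> y \<in> genideal R Z" using genideal_self[OF assms(2)] assms(5) by blast
  then show ?thesis
    using assms by (simp add: quotient_eq_iff_same_a_r_cos[OF I])
qed

section \<open>The free algebra as a ring with carrier\<close>

locale yokonuma_params =
  fixes d m n :: nat
  assumes d_pos: "0 < d" and m_pos: "0 < m" and n_pos: "0 < n"
begin

abbreviation F :: "nc_poly ring" where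
  "F \<equiv> free_alg m n"

abbreviation Y :: "nc_poly set ring" where
  "Y \<equiv> YH d m n"

abbreviation c :: "nc_poly \<Rightarrow> nc_poly set" where
  "c \<equiv> cls d m n"

lemma free_alg_ops [simp]: "mult F = (*)" "one F = 1" "zero F = 0" "add F = (+)"
  by (simp_all add: free_alg_def)

text \<open>As \<open>0\<close> lies in the Laurent ring, the coefficient condition may range over
  all words, which suits the pointwise lookup rules.\<close>

lemma mem_free_alg:
  "f \<in> carrier F \<longleftrightarrow>
    (\<forall>w \<in> Poly_Mapping.keys f. set (letters w) \<subseteq> gens n) \<and> (\<forall>w. Poly_Mapping.lookup f w \<in> laurent_ring m)"
  using laurent_ring_consts(1)[of m] unfolding free_alg_def by (fastforce simp: in_keys_iff)

lemma F_one [simp]: "1 \<in> carrier F" and F_zero [simp]: "0 \<in> carrier F"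
  by (auto simp: mem_free_alg lookup_one zero_gen_word_def laurent_ring_consts when_def)

lemma F_add [simp]: "f \<in> carrier F \<Longrightarrow> h \<in> carrier F \<Longrightarrow> f + h \<in> carrier F"
  using Poly_Mapping.keys_add[of f h] by (fastforce simp: mem_free_alg lookup_add laurent_ring_add)

lemma F_uminus [simp]: "f \<in> carrier F \<Longrightarrow> - f \<in> carrier F"
  by (auto simp: mem_free_alg laurent_ring_uminus)

lemma F_diff [simp]: "f \<in> carrier F \<Longrightarrow> h \<in> carrier F \<Longrightarrow> f - h \<in> carrier F"
  using F_add[of f "- h"] by simp

lemma F_mult [simp]:
  assumes "f \<in> carrier F" "h \<in> carrier F"
  shows "f * h \<in> carrier F"
  unfolding mem_free_alg
proof safe
  fix w x assume "w \<in> Poly_Mapping.keys (f * h)" "x \<in> set (letters w)"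
  then obtain a b where "w = a + b" "a \<in> Poly_Mapping.keys f" "b \<in> Poly_Mapping.keys h"
    using keys_mult[of f h] by blast
  then show "x \<in> gens n"
    using assms \<open>x \<in> _\<close> unfolding mem_free_alg plus_gen_word_def by auto
next
  fix w
  show "Poly_Mapping.lookup (f * h) w \<in> laurent_ring m"
    using assms unfolding lookup_mult mem_free_alg
    by (auto intro!: laurent_ring_Sum_any laurent_ring_mult simp: when_def laurent_ring_consts)
qed

lemma F_pow [simp]: "f \<in> carrier F \<Longrightarrow> f ^ i \<in> carrier F"
  by (induction i) auto

lemma F_sum [simp]: "(\<And>x. x \<in> T \<Longrightarrow> f x \<in> carrier F) \<Longrightarrow> sum f T \<in> carrier F"
  by (induction T rule: infinite_finite_induct) auto

lemma F_scal [simp]: "a \<in> laurent_ring m \<Longrightarrow> scal a \<in> carrier F"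
  by (auto simp: mem_free_alg scal_def lookup_single when_def laurent_ring_consts zero_gen_word_def)

lemma F_gen: "l \<in> gens n \<Longrightarrow> gen l \<in> carrier F"
  by (auto simp: mem_free_alg gen_def lookup_single when_def laurent_ring_consts)

lemma F_gens [simp]:
  "1 \<le> i \<Longrightarrow> i \<le> n \<Longrightarrow> gen (LT i) \<in> carrier F" "1 \<le> i \<Longrightarrow> i < n \<Longrightarrow> gen (LG i) \<in> carrier F"
  "gen LX \<in> carrier F" "gen LXinv \<in> carrier F"
  using n_pos by (auto intro!: F_gen simp: gens_def)

lemma F_prod_list [simp]: "(\<And>x. x \<in> set xs \<Longrightarrow> f x \<in> carrier F) \<Longrightarrow> (\<Prod>x\<leftarrow>xs. f x) \<in> carrier F"
  by (induction xs) auto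

lemma F_e_elt [simp]: "1 \<le> i \<Longrightarrow> i < n \<Longrightarrow> e_elt d i \<in> carrier F"
  unfolding e_elt_def by (intro F_mult F_sum F_scal laurent_ring_consts) auto

lemma F_ring: "ring F"
proof (rule ringI)
  show "abelian_group F"
  proof (rule abelian_groupI)
    fix x assume "x \<in> carrier F"
    then show "\<exists>y\<in>carrier F. y \<oplus>\<^bsub>F\<^esub> x = \<zero>\<^bsub>F\<^esub>"
      by (intro bexI[of _ "- x"]) auto
  qed (auto simp: add.assoc add.commute)
  show "monoid F"
    by (rule monoidI) (auto simp: mult.assoc)
qed (auto simp: distrib_left distrib_right)

sublocale F: ring F
  by (rule F_ring)

lemma F_minus: "f \<in> carrier F \<Longrightarrow> h \<in> carrier F \<Longrightarrow> f \<ominus>\<^bsub>F\<^esub> h = f - h"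
  using F.minus_equality[of "- h" h] by (simp add: a_minus_def)

lemma transpose_range:
  "1 \<le> i \<Longrightarrow> i < n \<Longrightarrow> 1 \<le> j \<Longrightarrow> j \<le> n \<Longrightarrow>
    1 \<le> Transposition.transpose i (Suc i) j \<and> Transposition.transpose i (Suc i) j \<le> n"
  by (auto simp: Transposition.transpose_def)

lemma relators_closed: "relators d m n \<subseteq> carrier F"
proof -
  have "scal (q_var - q_inv) \<in> carrier F"
    by (intro F_scal laurent_ring_diff laurent_ring_consts)
  moreover have "(\<Prod>i\<leftarrow>[1..<Suc m]. gen LX - scal (v_var i)) \<in> carrier F"
    by (intro F_prod_list F_diff F_scal laurent_ring_consts) auto
  ultimately show ?thesis
    unfolding relators_def by (auto simp: transpose_range[simplified] simp del: upt_Suc)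
qed

section \<open>The quotient algebra and the class map\<close>

lemma ideal: "ideal (rel_ideal d m n) F"
  unfolding rel_ideal_def by (rule F.genideal_ideal[OF relators_closed])

sublocale Y: ring Y
  unfolding YH_def by (rule ideal.quotient_is_ring[OF ideal])

lemma c_hom: "c \<in> ring_hom F Y"
  using ideal.rcos_ring_hom[OF ideal] by (simp add: YH_def cls_def[abs_def])

lemma c_simps:
  "f \<in> carrier F \<Longrightarrow> c f \<in> carrier Y"
  "f \<in> carrier F \<Longrightarrow> h \<in> carrier F \<Longrightarrow> c (f * h) = c f \<otimes>\<^bsub>Y\<^esub> c h"
  "f \<in> carrier F \<Longrightarrow> h \<in> carrier F \<Longrightarrow> c (f + h) = c f \<oplus>\<^bsub>Y\<^esub> c h"
  "c 1 = \<one>\<^bsub>Y\<^esub>"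
  using c_hom by (auto simp: ring_hom_def Pi_iff)

lemma c_zero: "c 0 = \<zero>\<^bsub>Y\<^esub>"
  using ring_hom_zero[OF c_hom F_ring Y.ring_axioms] by simp

lemma c_pow: "f \<in> carrier F \<Longrightarrow> c (f ^ i) = c f [^]\<^bsub>Y\<^esub> i"
  by (induction i) (auto simp: c_simps power_Suc2 simp del: power_Suc)

lemma c_surj: "y \<in> carrier Y \<Longrightarrow> \<exists>f\<in>carrier F. y = c f"
  by (auto simp: YH_def FactRing_def A_RCOSETS_def' cls_def)

lemma c_sum_cong:
  assumes "\<And>s. s \<in> T \<Longrightarrow> f s \<in> carrier F" "\<And>s. s \<in> T \<Longrightarrow> h s \<in> carrier F" "\<And>s. s \<in> T \<Longrightarrow> c (f s) = c (h s)"
  shows "c (sum f T) = c (sum h T)"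
  using assms by (induction T rule: infinite_finite_induct) (auto simp: c_simps)

lemma relation:
  "f - h \<in> relators d m n \<Longrightarrow> f \<in> carrier F \<Longrightarrow> h \<in> carrier F \<Longrightarrow> c f = c h"
  unfolding cls_def rel_ideal_def
  by (intro genideal_relator_eq[OF F_ring relators_closed]) (auto simp: F_minus)

section \<open>The defining relations in the quotient\<close>

definition E :: "nat \<Rightarrow> nc_poly set" where
  "E i = c (scal (q_var - q_inv) * e_elt d i)"

abbreviation S :: "nc_poly set set" where
  "S \<equiv> (\<lambda>a. c (scal a)) ` laurent_ring m"

lemma rel_t_t:
  assumes "1 \<le> i" "i \<le> n" "1 \<le> j" "j \<le> n"
  shows "c (gen (LT i) * gen (LT j)) = c (gen (LT j) * gen (LT i))"
proof (rule relation)
  have "i \<in> {1..n} \<and> j \<in> {1..n}" using assms by simp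
  then show "gen (LT i) * gen (LT j) - gen (LT j) * gen (LT i) \<in> relators d m n"
    unfolding relators_def by blast
qed (use assms in auto)

lemma rel_t_g:
  assumes "1 \<le> i" "i < n" "1 \<le> j" "j \<le> n"
  shows "c (gen (LT j) * gen (LG i)) = c (gen (LG i) * gen (LT (Transposition.transpose i (Suc i) j)))"
proof (rule relation)
  have "i \<in> {1..<n} \<and> j \<in> {1..n}" using assms by simp
  then have "gen (LT j) * gen (LG i) - gen (LG i) * gen (LT (Transposition.transpose i (i + 1) j))
      \<in> relators d m n"
    unfolding relators_def by blast
  then show "gen (LT j) * gen (LG i) - gen (LG i) * gen (LT (Transposition.transpose i (Suc i) j))
      \<in> relators d m n"
    by simp
qed (use assms transpose_range[OF assms] in auto)

lemma rel_t_pow: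
  assumes "1 \<le> j" "j \<le> n"
  shows "c (gen (LT j) ^ d) = c 1"
proof (rule relation)
  have "j \<in> {1..n}" using assms by simp
  then show "gen (LT j) ^ d - 1 \<in> relators d m n"
    unfolding relators_def by blast
qed (use assms in auto)

lemma rel_g_sq:
  assumes "1 \<le> i" "i < n"
  shows "c (gen (LG i) ^ 2) = c (1 + scal (q_var - q_inv) * e_elt d i * gen (LG i))"
proof (rule relation)
  have "i \<in> {1..<n}" using assms by simp
  then show "gen (LG i) ^ 2 - (1 + scal (q_var - q_inv) * e_elt d i * gen (LG i)) \<in> relators d m n"
    unfolding relators_def by blast
qed (use assms in \<open>auto intro!: F_add F_mult F_scal laurent_ring_diff laurent_ring_consts\<close>)

lemma rel_g_far:
  assumes "1 \<le> i" "i + 1 < j" "j < n"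
  shows "c (gen (LG i) * gen (LG j)) = c (gen (LG j) * gen (LG i))"
proof (rule relation)
  have "i \<in> {1..<n} \<and> j \<in> {1..<n} \<and> (i + 1 < j \<or> j + 1 < i)" using assms by simp
  then show "gen (LG i) * gen (LG j) - gen (LG j) * gen (LG i) \<in> relators d m n"
    unfolding relators_def by blast
qed (use assms in auto)

lemma rel_g_braid:
  assumes "1 \<le> i" "i + 1 < n"
  shows "c (gen (LG i) * gen (LG (i + 1)) * gen (LG i)) = c (gen (LG (i + 1)) * gen (LG i) * gen (LG (i + 1)))"
proof (rule relation)
  have "i \<in> {1..<n} \<and> i + 1 \<in> {1..<n}" using assms by simp
  then show "gen (LG i) * gen (LG (i + 1)) * gen (LG i) - gen (LG (i + 1)) * gen (LG i) * gen (LG (i + 1))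
      \<in> relators d m n"
    unfolding relators_def by blast
qed (use assms in auto)

lemma rel_X_g1:
  assumes "2 \<le> n"
  shows "c (gen LX * gen (LG 1) * gen LX * gen (LG 1)) = c (gen (LG 1) * gen LX * gen (LG 1) * gen LX)"
proof (rule relation)
  show "gen LX * gen (LG 1) * gen LX * gen (LG 1) - gen (LG 1) * gen LX * gen (LG 1) * gen LX
      \<in> relators d m n"
    unfolding relators_def if_P[OF assms] by blast
qed (use assms in auto)

lemma rel_X_g:
  assumes "2 \<le> i" "i < n"
  shows "c (gen LX * gen (LG i)) = c (gen (LG i) * gen LX)"
proof (rule relation)
  have "i \<in> {2..<n}" using assms by simp
  then show "gen LX * gen (LG i) - gen (LG i) * gen LX \<in> relators d m n"
    unfolding relators_def by blast
qed (use assms in auto)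

lemma rel_X_t:
  assumes "1 \<le> j" "j \<le> n"
  shows "c (gen LX * gen (LT j)) = c (gen (LT j) * gen LX)"
proof (rule relation)
  have "j \<in> {1..n}" using assms by simp
  then show "gen LX * gen (LT j) - gen (LT j) * gen LX \<in> relators d m n"
    unfolding relators_def by blast
qed (use assms in auto)

lemma rel_X_inv: "c (gen LX * gen LXinv) = c 1" "c (gen LXinv * gen LX) = c 1"
proof -
  have "gen LX * gen LXinv - 1 \<in> relators d m n" "gen LXinv * gen LX - 1 \<in> relators d m n"
    unfolding relators_def by blast+
  then show "c (gen LX * gen LXinv) = c 1" "c (gen LXinv * gen LX) = c 1"
    by - (rule relation; simp)+
qed

lemma E_generated:
  assumes "1 \<le> i" "i < n"
  shows "E i \<in> generate_ring Y (S \<union> {c (gen (LT i)), c (gen (LT (Suc i)))})"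
proof -
  define K where "K = generate_ring Y (S \<union> {c (gen (LT i)), c (gen (LT (Suc i)))})"
  have K: "subring K Y"
    unfolding K_def using assms by (intro Y.generate_ring_is_subring) (auto simp: c_simps)
  have t: "c (gen (LT i)) \<in> K" "c (gen (LT (Suc i))) \<in> K" and s: "\<And>a. a \<in> laurent_ring m \<Longrightarrow> c (scal a) \<in> K"
    unfolding K_def by (auto intro: generate_ring.incl)
  have sum: "c (\<Sum>s\<in>T. gen (LT i) ^ s * gen (LT (Suc i)) ^ (d - s)) \<in> K" for T
    using assms
    by (induction T rule: infinite_finite_induct)
      (auto simp: c_simps c_zero c_pow intro!: subringE(2,6,7)[OF K] Y.nat_pow_subring K t)
  have q: "q_var - q_inv \<in> laurent_ring m"
    by (intro laurent_ring_diff laurent_ring_consts)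
  have "E i \<in> K"
    using assms q unfolding E_def e_elt_def
    by (auto simp: c_simps laurent_ring_consts intro!: subringE(6)[OF K] s sum)
  then show ?thesis by (simp only: K_def)
qed

text \<open>Passing \<open>g i\<close> exchanges \<open>t i\<close> and \<open>t (i+1)\<close>, so
  the claim rests on the symmetry of \<open>e_i\<close> in these two elements, which holds modulo
  \<open>t_j^d = 1\<close>.\<close>

lemma E_commutes_g:
  assumes "1 \<le> i" "i < n"
  shows "E i \<otimes>\<^bsub>Y\<^esub> c (gen (LG i)) = c (gen (LG i)) \<otimes>\<^bsub>Y\<^esub> E i"
proof -
  let ?x = "gen (LT i)" and ?y = "gen (LT (Suc i))" and ?g = "gen (LG i)"
  define P where "P = (\<Sum>s<d. ?x ^ s * ?y ^ (d - s))"
  define Q where "Q = (\<Sum>s<d. ?y ^ s * ?x ^ (d - s))"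
  have [simp]: "?x \<in> carrier F" "?y \<in> carrier F" "?g \<in> carrier F" using assms by auto
  have [simp]: "P \<in> carrier F" "Q \<in> carrier F" by (auto simp: P_def Q_def)
  have xy: "c ?x \<otimes>\<^bsub>Y\<^esub> c ?y = c ?y \<otimes>\<^bsub>Y\<^esub> c ?x"
    using assms rel_t_t[of i "Suc i"] by (simp add: c_simps)
  have cX: "c ?x \<in> Y.centralizer (c ?y)"
    using xy by (auto simp: Y.centralizer_def c_simps)
  have pow_xy: "c (?x ^ r * ?y ^ s) = c (?y ^ s * ?x ^ r)" for r s
    using Y.centralizerD[OF Y.centralizer_pow[OF Y.centralizer_sym[OF Y.centralizer_pow[OF cX]]], of r s]
    by (simp add: c_simps c_pow)
  \<comment> \<open>The sum over \<open>s < d\<close> is not invariant under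
    \<open>s -> d - s\<close>. Adding the term \<open>s = d\<close> makes it so, and both added
    terms \<open>x^d\<close> and \<open>y^d\<close> become \<open>1\<close>.\<close>
  have "c (P + ?x ^ d) = c (\<Sum>s\<le>d. ?x ^ s * ?y ^ (d - s))"
    by (simp add: P_def lessThan_Suc_atMost[symmetric])
  also have "\<dots> = c (\<Sum>s\<le>d. ?y ^ (d - s) * ?x ^ s)"
    by (intro c_sum_cong pow_xy) auto
  also have "(\<Sum>s\<le>d. ?y ^ (d - s) * ?x ^ s) = (\<Sum>s\<le>d. ?y ^ s * ?x ^ (d - s))"
    by (rule sum.reindex_bij_witness[of _ "\<lambda>s. d - s" "\<lambda>s. d - s"]) auto
  also have "c \<dots> = c (Q + ?y ^ d)"
    by (simp add: Q_def lessThan_Suc_atMost[symmetric])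
  finally have "c P \<oplus>\<^bsub>Y\<^esub> \<one>\<^bsub>Y\<^esub> = c Q \<oplus>\<^bsub>Y\<^esub> \<one>\<^bsub>Y\<^esub>"
    using assms by (simp add: c_simps rel_t_pow)
  then have PQ: "c P = c Q"
    by (simp add: c_simps)
  have x: "c (?x ^ r * ?g) = c (?g * ?y ^ r)" and y: "c (?y ^ r * ?g) = c (?g * ?x ^ r)" for r
  proof -
    have 1: "c ?x \<otimes>\<^bsub>Y\<^esub> c ?g = c ?g \<otimes>\<^bsub>Y\<^esub> c ?y" "c ?y \<otimes>\<^bsub>Y\<^esub> c ?g = c ?g \<otimes>\<^bsub>Y\<^esub> c ?x"
      using assms rel_t_g[of i i] rel_t_g[of i "Suc i"]
      by (simp_all add: c_simps Transposition.transpose_def)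
    have "c ?x [^]\<^bsub>Y\<^esub> r \<otimes>\<^bsub>Y\<^esub> c ?g = c ?g \<otimes>\<^bsub>Y\<^esub> c ?y [^]\<^bsub>Y\<^esub> r \<and>
      c ?y [^]\<^bsub>Y\<^esub> r \<otimes>\<^bsub>Y\<^esub> c ?g = c ?g \<otimes>\<^bsub>Y\<^esub> c ?x [^]\<^bsub>Y\<^esub> r"
    proof (induction r)
      case (Suc r)
      then show ?case
        by (auto simp: Y.m_assoc c_simps 1) (auto simp: Y.m_assoc[symmetric] c_simps)
    qed (auto simp: c_simps)
    then show "c (?x ^ r * ?g) = c (?g * ?y ^ r)" "c (?y ^ r * ?g) = c (?g * ?x ^ r)"
      by (auto simp: c_simps c_pow)
  qed
  have "c (?x ^ s * ?y ^ (d - s) * ?g) = c (?g * (?y ^ s * ?x ^ (d - s)))" for s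
  proof -
    have "c (?x ^ s * ?y ^ (d - s) * ?g) = c (?x ^ s) \<otimes>\<^bsub>Y\<^esub> c (?y ^ (d - s) * ?g)"
      by (simp add: c_simps Y.m_assoc)
    also have "\<dots> = c (?x ^ s * ?g) \<otimes>\<^bsub>Y\<^esub> c (?x ^ (d - s))"
      by (simp add: y c_simps Y.m_assoc)
    also have "\<dots> = c (?g * (?y ^ s * ?x ^ (d - s)))"
      by (simp add: x c_simps Y.m_assoc)
    finally show ?thesis .
  qed
  then have "c (P * ?g) = c (?g * Q)"
    unfolding P_def Q_def sum_distrib_left sum_distrib_right by (intro c_sum_cong) auto
  then have Pg: "c (P * ?g) = c (?g * P)"
    using PQ by (simp add: c_simps)
  define a where "a = scal (q_var - q_inv) * scal (laurent_const (1 / of_nat d))"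
  have [simp]: "a \<in> carrier F"
    unfolding a_def by (intro F_mult F_scal laurent_ring_diff laurent_ring_consts)
  have E: "E i = c (a * P)"
    by (simp add: E_def e_elt_def a_def P_def mult.assoc)
  have "E i \<otimes>\<^bsub>Y\<^esub> c ?g = c a \<otimes>\<^bsub>Y\<^esub> c (P * ?g)"
    by (simp add: E c_simps Y.m_assoc)
  also have "\<dots> = c (a * ?g * P)"
    by (simp add: Pg c_simps Y.m_assoc)
  also have "a * ?g = ?g * a"
    unfolding a_def by (metis mult.assoc scal_commute)
  finally show ?thesis
    by (simp add: E c_simps Y.m_assoc)
qed

text \<open>The relations are images of relators under the class map; centrality of the scalars
  comes from \<open>scal_commute\<close>, every element being the class of a polynomial.\<close>

sublocale yokonuma_hecke Y n d "g_elt d m n" "t_elt d m n" "X_elt d m n" "Xt_elt d m n" E "c (gen LXinv)" S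
proof
  fix s y assume "s \<in> S" "y \<in> carrier Y"
  then obtain a f where "a \<in> laurent_ring m" "s = c (scal a)" "f \<in> carrier F" "y = c f"
    using c_surj by blast
  then show "s \<otimes>\<^bsub>Y\<^esub> y = y \<otimes>\<^bsub>Y\<^esub> s"
    using scal_commute[of a f] by (simp flip: c_simps(2))
next
  fix j :: nat assume "1 \<le> j"
  then show "X_elt d m n (Suc j) = g_elt d m n j \<otimes>\<^bsub>Y\<^esub> X_elt d m n j \<otimes>\<^bsub>Y\<^esub> g_elt d m n j"
    "Xt_elt d m n (Suc j) = inv\<^bsub>Y\<^esub> (g_elt d m n j) \<otimes>\<^bsub>Y\<^esub> Xt_elt d m n j \<otimes>\<^bsub>Y\<^esub> g_elt d m n j"
    by (cases j; simp)+
next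
  show "X_elt d m n (Suc 0) \<otimes>\<^bsub>Y\<^esub> c (gen LXinv) = \<one>\<^bsub>Y\<^esub>"
    "c (gen LXinv) \<otimes>\<^bsub>Y\<^esub> X_elt d m n (Suc 0) = \<one>\<^bsub>Y\<^esub>"
    using rel_X_inv by (simp_all add: c_simps)
next
  fix i j :: nat assume ij: "1 \<le> i" "i + 1 < j" "j < n"
  show "g_elt d m n i \<otimes>\<^bsub>Y\<^esub> g_elt d m n j = g_elt d m n j \<otimes>\<^bsub>Y\<^esub> g_elt d m n i"
    using rel_g_far[OF ij] ij by (simp add: c_simps)
next
  fix i :: nat assume i: "1 \<le> i" "i + 1 < n"
  show "g_elt d m n i \<otimes>\<^bsub>Y\<^esub> g_elt d m n (i + 1) \<otimes>\<^bsub>Y\<^esub> g_elt d m n i =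
      g_elt d m n (i + 1) \<otimes>\<^bsub>Y\<^esub> g_elt d m n i \<otimes>\<^bsub>Y\<^esub> g_elt d m n (i + 1)"
    using rel_g_braid[OF i] i by (simp add: c_simps)
next
  assume n: "2 \<le> n"
  show "X_elt d m n (Suc 0) \<otimes>\<^bsub>Y\<^esub> g_elt d m n 1 \<otimes>\<^bsub>Y\<^esub> X_elt d m n (Suc 0) \<otimes>\<^bsub>Y\<^esub> g_elt d m n 1 =
      g_elt d m n 1 \<otimes>\<^bsub>Y\<^esub> X_elt d m n (Suc 0) \<otimes>\<^bsub>Y\<^esub> g_elt d m n 1 \<otimes>\<^bsub>Y\<^esub> X_elt d m n (Suc 0)"
    using rel_X_g1[OF n] n by (simp add: c_simps)
next
  fix i :: nat assume i: "2 \<le> i" "i < n"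
  show "X_elt d m n (Suc 0) \<otimes>\<^bsub>Y\<^esub> g_elt d m n i = g_elt d m n i \<otimes>\<^bsub>Y\<^esub> X_elt d m n (Suc 0)"
    using rel_X_g[OF i] i by (simp add: c_simps)
next
  fix i :: nat assume i: "1 \<le> i" "i \<le> n"
  show "X_elt d m n (Suc 0) \<otimes>\<^bsub>Y\<^esub> t_elt d m n i = t_elt d m n i \<otimes>\<^bsub>Y\<^esub> X_elt d m n (Suc 0)"
    using rel_X_t[OF i] i by (simp add: c_simps)
next
  fix i :: nat assume i: "1 \<le> i" "i < n"
  have q: "scal (q_var - q_inv) \<in> carrier F" by (intro F_scal laurent_ring_diff laurent_ring_consts)
  show "g_elt d m n i \<otimes>\<^bsub>Y\<^esub> g_elt d m n i = \<one>\<^bsub>Y\<^esub> \<oplus>\<^bsub>Y\<^esub> E i \<otimes>\<^bsub>Y\<^esub> g_elt d m n i"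
    using rel_g_sq[OF i] i q by (simp add: c_simps E_def power2_eq_square)
next
  fix i j :: nat assume ij: "1 \<le> i" "i < n" "1 \<le> j" "j \<le> n"
  show "t_elt d m n j \<otimes>\<^bsub>Y\<^esub> g_elt d m n i =
      g_elt d m n i \<otimes>\<^bsub>Y\<^esub> t_elt d m n (Transposition.transpose i (Suc i) j)"
    using rel_t_g[OF ij] transpose_range[OF ij] ij by (simp add: c_simps)
next
  fix i j :: nat assume ij: "1 \<le> i" "i \<le> n" "1 \<le> j" "j \<le> n"
  show "t_elt d m n i \<otimes>\<^bsub>Y\<^esub> t_elt d m n j = t_elt d m n j \<otimes>\<^bsub>Y\<^esub> t_elt d m n i"
    using rel_t_t[OF ij] ij by (simp add: c_simps)
next
  fix j :: nat assume j: "1 \<le> j" "j \<le> n"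
  show "t_elt d m n j [^]\<^bsub>Y\<^esub> d = \<one>\<^bsub>Y\<^esub>"
    using rel_t_pow[OF j] j by (simp add: c_simps flip: c_pow)
qed (use d_pos E_generated E_commutes_g in \<open>auto simp: c_simps\<close>)

lemma sub_eq_subYH: "sub k = subYH d m n k"
  unfolding sub_def subYH_def sub_gens_def gens_def
  by (rule arg_cong[where f = "generate_ring Y"]) auto

lemma basis_elt_eq:
  "basis_elt d m n a b w =
    lprod Y (map (\<lambda>i. X_elt d m n i [^]\<^bsub>Y\<^esub> a i) [1..<Suc n]) \<otimes>\<^bsub>Y\<^esub>
    lprod Y (map (\<lambda>i. t_elt d m n i [^]\<^bsub>Y\<^esub> b i) [1..<Suc n]) \<otimes>\<^bsub>Y\<^esub> gprod (SOME is. reduced_expr n w is)"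
  by (simp add: basis_elt_def g_perm_def gprod_def del: upt_Suc)

end

theorem proposition7p1:
  fixes d m n :: nat and tau :: "nc_poly set \<Rightarrow> laurent"
  assumes "d > 0" and "n > 0" and "m > 0"
    and "markov_trace d m n 0 (\<lambda>a b. if a = 0 \<and> b = 0 then 1 else 0) tau"
  shows "\<forall>a b w. (\<forall>i\<in>{1..n}. a i < m) \<and> (\<forall>i\<in>{1..n}. b i < d) \<and> w permutes {1..n} \<longrightarrow>
           tau (basis_elt d m n a b w) =
             (if w = id \<and> (\<forall>i\<in>{1..n}. a i = 0 \<and> b i = 0) then 1 else 0)"
proof (intro allI impI, elim conjE)
  fix a b w
  assume a: "\<forall>i\<in>{1..n}. a i < m" and b: "\<forall>i\<in>{1..n}. b i < d" and w: "w permutes {1..n}"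
  interpret yokonuma_params d m n
    using assms by unfold_locales
  note M = assms(4)[unfolded markov_trace_def, folded sub_eq_subYH]
  interpret T: yokonuma_trace Y n d "g_elt d m n" "t_elt d m n" "X_elt d m n" "Xt_elt d m n" E
    "c (gen LXinv)" S m tau
  proof
    \<comment> \<open>\<open>markov_trace\<close> indexes this rule by the number of strands, with
      \<open>g_(k-1)\<close>; hence the instance \<open>Suc k\<close>.\<close>
    fix k u assume "1 \<le> k" "k < n" "u \<in> sub k"
    then show "tau (g_elt d m n k \<otimes>\<^bsub>Y\<^esub> u) = 0"
      using M[THEN conjunct2, THEN conjunct2, THEN conjunct2, THEN conjunct2, THEN conjunct2, THEN conjunct2,
        THEN conjunct2, THEN conjunct2, THEN conjunct1, rule_format, of "Suc k" u] by auto
  next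
    fix k u i j assume "k < n" "u \<in> sub k" "i < m" "j < d"
    then show "tau (Xt_elt d m n (Suc k) [^]\<^bsub>Y\<^esub> i \<otimes>\<^bsub>Y\<^esub> t_elt d m n (Suc k) [^]\<^bsub>Y\<^esub> j \<otimes>\<^bsub>Y\<^esub> u) =
        (if i = 0 \<and> j = 0 then tau u else 0)"
      using M[THEN conjunct2, THEN conjunct2, THEN conjunct2, THEN conjunct2, THEN conjunct2, THEN conjunct2,
        THEN conjunct2, THEN conjunct2, THEN conjunct2, rule_format, of "Suc k" u i j] by auto
  qed (use M assms in auto)
  let ?is = "SOME is. reduced_expr n w is"
  have red: "reduced_expr n w ?is" using w by (rule reduced_expr_SOME)
  then obtain vs where vs: "normal_word n vs" "braid_eq ?is vs" "vs = [] \<longleftrightarrow> w = id"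
    by (rule reduced_expr_normal)
  \<comment> \<open>The reduced expression picked by \<open>SOME\<close> may be replaced by its
    normal word.\<close>
  have "gprod ?is = gprod vs"
    using red vs(2) by (intro gprod_braid_eq) (auto simp: reduced_expr_def)
  then show "tau (basis_elt d m n a b w) = (if w = id \<and> (\<forall>i\<in>{1..n}. a i = 0 \<and> b i = 0) then 1 else 0)"
    using T.tau_normal_word[OF vs(1) _ a b] vs(3)
    by (simp add: basis_elt_eq T.Xprod_def T.tprod_def del: upt_Suc)
qed

end
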